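(* The Grigorchuk group $\Gamma$ is hereditarily conjugacy separable, i.e. $\Gamma$ and each of its finite-index subgroups are conjugacy separable. In particular, $\Gamma$ is $2$-hereditarily conjugacy separable.
   Context: View $\{0,1\}^*$ as the vertices of the infinite rooted binary tree $T$ (root the empty word; each $\sigma$ has children $\sigma 0,\sigma 1$). The Grigorchuk group is $\Gamma = \langle a,b,c,d\rangle \leq \mathrm{Aut}(T)$, where the generators are defined recursively, for all $\sigma\in\{0,1\}^*$, by $a(0\sigma)=1\sigma$, $a(1\sigma)=0\sigma$; $b(0\sigma)=0a(\sigma)$, $b(1\sigma)=1c(\sigma)$; $c(0\sigma)=0a(\sigma)$, $c(1\sigma)=1d(\sigma)$; $d(0\sigma)=0\sigma$, $d(1\sigma)=1b(\sigma)$. A group $G$ is conjugacy separable if for every pair of non-conjugate elements $f,g\in G$ there is a surjective homomorphism $\pi$ from $G$ onto a finite group such that $\pi(f)$ and $\pi(g)$ are not conjugate in the image; it is $2$-conjugacy separable if the finite group can always be chosen to be a $2$-group. A group $G$ is $2$-hereditarily conjugacy separable if $G$ is $2$-conjugacy separable and every subgroup $H\leq G$ containing a normal subgroup $N \unlhd G$ with $G/N$ a finite $2$-group is $2$-conjugacy separable. *)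

theory Defs
  imports "HOL-Algebra.Algebra"
begin

section \<open>Conjugacy separability\<close>

definition conjugate :: "('a, 'm) monoid_scheme \<Rightarrow> 'a \<Rightarrow> 'a \<Rightarrow> bool" where
  "conjugate G f g \<longleftrightarrow> (\<exists>h\<in>carrier G. g = h \<otimes>\<^bsub>G\<^esub> f \<otimes>\<^bsub>G\<^esub> inv\<^bsub>G\<^esub> h)"

definition finite_2_group :: "('a, 'm) monoid_scheme \<Rightarrow> bool" where
  "finite_2_group G \<longleftrightarrow> group G \<and> finite (carrier G) \<and> (\<exists>n. order G = 2 ^ n)"

text \<open>A definition cannot quantify over all types, so finite groups are taken with carrier a finite
  set of natural numbers. Every finite group is isomorphic to such a group, so nothing is lost.\<close>

definition conjugacy_separable :: "('a, 'm) monoid_scheme \<Rightarrow> bool" where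
  "conjugacy_separable G \<longleftrightarrow>
     (\<forall>f\<in>carrier G. \<forall>g\<in>carrier G. \<not> conjugate G f g \<longrightarrow>
        (\<exists>(Q :: nat monoid) \<pi>. group Q \<and> finite (carrier Q) \<and> \<pi> \<in> epi G Q \<and>
           \<not> conjugate Q (\<pi> f) (\<pi> g)))"

definition two_conjugacy_separable :: "('a, 'm) monoid_scheme \<Rightarrow> bool" where
  "two_conjugacy_separable G \<longleftrightarrow>
     (\<forall>f\<in>carrier G. \<forall>g\<in>carrier G. \<not> conjugate G f g \<longrightarrow>
        (\<exists>(Q :: nat monoid) \<pi>. finite_2_group Q \<and> \<pi> \<in> epi G Q \<and>
           \<not> conjugate Q (\<pi> f) (\<pi> g)))"

definition hereditarily_conjugacy_separable :: "('a, 'm) monoid_scheme \<Rightarrow> bool" where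
  "hereditarily_conjugacy_separable G \<longleftrightarrow>
     conjugacy_separable G \<and>
     (\<forall>H. subgroup H G \<and> finite (rcosets\<^bsub>G\<^esub> H) \<longrightarrow> conjugacy_separable (G\<lparr>carrier := H\<rparr>))"

definition two_hereditarily_conjugacy_separable :: "('a, 'm) monoid_scheme \<Rightarrow> bool" where
  "two_hereditarily_conjugacy_separable G \<longleftrightarrow>
     two_conjugacy_separable G \<and>
     (\<forall>H N. subgroup H G \<and> N \<lhd> G \<and> N \<subseteq> H \<and> finite_2_group (G Mod N) \<longrightarrow>
        two_conjugacy_separable (G\<lparr>carrier := H\<rparr>))"

section \<open>The rooted binary tree and the Grigorchuk group\<close>

text \<open>Vertices are finite words over \<open>{0, 1}\<close>, with \<open>False\<close> for \<open>0\<close> and \<open>True\<close> for \<open>1\<close>;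
  the head of the list is the first letter of the word.\<close>

type_synonym word = "bool list"

definition tree_adj :: "word \<Rightarrow> word \<Rightarrow> bool" where
  "tree_adj u v \<longleftrightarrow> (\<exists>x. v = u @ [x]) \<or> (\<exists>x. u = v @ [x])"

definition tree_Aut :: "(word \<Rightarrow> word) monoid" where
  "tree_Aut = \<lparr>carrier = {f. bij f \<and> f [] = [] \<and> (\<forall>u v. tree_adj (f u) (f v) \<longleftrightarrow> tree_adj u v)},
               monoid.mult = (\<circ>), one = id\<rparr>"

fun gen_a :: "word \<Rightarrow> word" where
  "gen_a [] = []"
| "gen_a (False # s) = True # s"
| "gen_a (True # s) = False # s"

fun gen_b :: "word \<Rightarrow> word" and gen_c :: "word \<Rightarrow> word" and gen_d :: "word \<Rightarrow> word" where
  "gen_b [] = []"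
| "gen_b (False # s) = False # gen_a s"
| "gen_b (True # s) = True # gen_c s"
| "gen_c [] = []"
| "gen_c (False # s) = False # gen_a s"
| "gen_c (True # s) = True # gen_d s"
| "gen_d [] = []"
| "gen_d (False # s) = False # s"
| "gen_d (True # s) = True # gen_b s"

definition Grigorchuk :: "(word \<Rightarrow> word) monoid" where
  "Grigorchuk = tree_Aut\<lparr>carrier := generate tree_Aut {gen_a, gen_b, gen_c, gen_d}\<rparr>"

lemma group_tree_Aut: "group tree_Aut"
proof (rule groupI)
  fix f assume f: "f \<in> carrier tree_Aut"
  then have bij: "bij f" and root: "f [] = []"
    and adj: "tree_adj (f u) (f v) \<longleftrightarrow> tree_adj u v" for u v
    by (simp_all add: tree_Aut_def)
  have "tree_adj (inv_into UNIV f u) (inv_into UNIV f v) \<longleftrightarrow> tree_adj u v" for u v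
    using adj[of "inv_into UNIV f u" "inv_into UNIV f v"] bij by (simp add: bij_is_surj surj_f_inv_f)
  moreover have "inv_into UNIV f [] = []"
    using bij root by (metis bij_is_inj inv_f_f)
  ultimately have "inv_into UNIV f \<in> carrier tree_Aut"
    using bij by (simp add: tree_Aut_def bij_imp_bij_inv)
  moreover have "inv_into UNIV f \<circ> f = id"
    using bij by (simp add: bij_is_inj)
  ultimately show "\<exists>g\<in>carrier tree_Aut. g \<otimes>\<^bsub>tree_Aut\<^esub> f = \<one>\<^bsub>tree_Aut\<^esub>"
    by (auto simp: tree_Aut_def)
qed (auto simp: tree_Aut_def bij_comp comp_assoc)

lemma gen_a_invol: "gen_a (gen_a s) = s"
  by (cases s rule: gen_a.cases) simp_all

lemma gen_bcd_invol: "gen_b (gen_b s) = s" "gen_c (gen_c s) = s" "gen_d (gen_d s) = s"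
  by (induction s and s and s rule: gen_b_gen_c_gen_d.induct) (simp_all add: gen_a_invol)

lemma gen_a_snoc: "\<exists>y. gen_a (s @ [x]) = gen_a s @ [y]"
  by (cases s rule: gen_a.cases; cases x) (simp_all add: ex_bool_eq)

lemma gen_bcd_snoc:
  "\<exists>y. gen_b (s @ [x]) = gen_b s @ [y]"
  "\<exists>y. gen_c (s @ [x]) = gen_c s @ [y]"
  "\<exists>y. gen_d (s @ [x]) = gen_d s @ [y]"
  by (induction s and s and s rule: gen_b_gen_c_gen_d.induct)
     (cases x; simp add: gen_a_snoc ex_bool_eq)+

lemma tree_Aut_involI:
  assumes invol: "\<And>s. f (f s) = s" and root: "f [] = []"
    and snoc: "\<And>s x. \<exists>y. f (s @ [x]) = f s @ [y]"
  shows "f \<in> carrier tree_Aut"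
proof -
  have *: "tree_adj (f u) (f v)" if "tree_adj u v" for u v
    using that snoc unfolding tree_adj_def by metis
  have "bij f"
    by (rule o_bij[of f]) (auto simp: invol)
  moreover have "tree_adj (f u) (f v) \<longleftrightarrow> tree_adj u v" for u v
    using *[of u v] *[of "f u" "f v"] by (auto simp: invol)
  ultimately show ?thesis
    using root by (simp add: tree_Aut_def)
qed

lemma generators_in_tree_Aut: "{gen_a, gen_b, gen_c, gen_d} \<subseteq> carrier tree_Aut"
  by (simp add: tree_Aut_involI gen_a_invol gen_bcd_invol gen_a_snoc gen_bcd_snoc)

lemma group_Grigorchuk: "group Grigorchuk"
  unfolding Grigorchuk_def
  using group.generate_is_subgroup[OF group_tree_Aut generators_in_tree_Aut]
  by (rule subgroup.subgroup_is_group) (rule group_tree_Aut)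

end

theory Submission imports Defs begin

text \<open>The key statement is about approximate conjugators: for every finite-index normal subgroup \<open>K\<close>
  there is a finite-index normal subgroup \<open>L\<close> such that every \<open>h\<close> conjugating \<open>f\<close> to \<open>g\<close> modulo \<open>L\<close> agrees
  modulo \<open>K\<close> with an element conjugating \<open>f\<close> to \<open>g\<close>. If \<open>f\<close>, \<open>g\<close> lie in a subgroup containing \<open>K\<close> and are
  not conjugate in it, they are then not conjugate in its image modulo \<open>L\<close>.

  By the congruence subgroup property it suffices to take \<open>K\<close> and \<open>L\<close> among the products \<open>K0 \<times> \<dots> \<times> K0\<close> on
  the levels of the tree, where \<open>K0\<close> is the normal closure of \<open>(ab)^2\<close>; these have finite 2-groups as
  quotients. Because \<open>K0 \<times> K0 \<subseteq> K0\<close>, conjugators modulo these subgroups can be corrected separately on the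
  two subtrees, so the statement for \<open>f\<close>, \<open>g\<close> follows from that for their sections, or for the product of the
  two sections if \<open>f\<close>, \<open>g\<close> swap the subtrees. A weighted word length decreases under this, up to conjugation,
  until only generators are left. Among these the recursion \<open>d = (1, b)\<close>, \<open>b = (a, c)\<close>, \<open>c = (a, d)\<close> lowers the
  level of \<open>K\<close> until \<open>K = K0\<close>, where the centralizer of \<open>d\<close> covers the whole first level stabilizer.\<close>

section \<open>The group as functions under composition, with induction over generators\<close>

abbreviation \<Gamma> :: "(word \<Rightarrow> word) set" where
  "\<Gamma> \<equiv> carrier Grigorchuk"

abbreviation iv :: "(word \<Rightarrow> word) \<Rightarrow> word \<Rightarrow> word" where
  "iv \<equiv> inv_into UNIV"

lemma mult_Grigorchuk: "f \<otimes>\<^bsub>Grigorchuk\<^esub> g = f \<circ> g"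
  and one_Grigorchuk: "\<one>\<^bsub>Grigorchuk\<^esub> = id"
  by (simp_all add: Grigorchuk_def tree_Aut_def)

lemma mult_tree_Aut: "f \<otimes>\<^bsub>tree_Aut\<^esub> g = f \<circ> g"
  and one_tree_Aut: "\<one>\<^bsub>tree_Aut\<^esub> = id"
  by (simp_all add: tree_Aut_def)

lemma Gamma_tree_Aut: "f \<in> \<Gamma> \<Longrightarrow> f \<in> carrier tree_Aut"
  using group.generate_incl[OF group_tree_Aut generators_in_tree_Aut]
  by (auto simp: Grigorchuk_def)

lemma Gamma_bij: "f \<in> \<Gamma> \<Longrightarrow> bij f"
  using Gamma_tree_Aut by (auto simp: tree_Aut_def)

lemma Gamma_id [simp]: "id \<in> \<Gamma>"
  using group.is_monoid[OF group_Grigorchuk] monoid.one_closed one_Grigorchuk by metis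

lemma Gamma_comp [simp]: "f \<in> \<Gamma> \<Longrightarrow> g \<in> \<Gamma> \<Longrightarrow> f \<circ> g \<in> \<Gamma>"
  using monoid.m_closed[OF group.is_monoid[OF group_Grigorchuk]] by (metis mult_Grigorchuk)

lemma m_inv_Grigorchuk: "f \<in> \<Gamma> \<Longrightarrow> inv\<^bsub>Grigorchuk\<^esub> f = iv f"
  using group.l_inv[OF group_Grigorchuk, of f] Gamma_bij[of f]
  by (metis bij_is_surj comp_id fun.map_id inv_unique_comp mult_Grigorchuk one_Grigorchuk
      group.r_inv[OF group_Grigorchuk])

lemma Gamma_inv [simp]: "f \<in> \<Gamma> \<Longrightarrow> iv f \<in> \<Gamma>"
  using group.inv_closed[OF group_Grigorchuk, of f] by (simp add: m_inv_Grigorchuk)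

lemma Gamma_gens [simp]: "gen_a \<in> \<Gamma>" "gen_b \<in> \<Gamma>" "gen_c \<in> \<Gamma>" "gen_d \<in> \<Gamma>"
  by (auto simp: Grigorchuk_def intro: generate.incl)

lemma Gamma_cancel [simp]:
  assumes "f \<in> \<Gamma>"
  shows "f \<circ> iv f = id" "iv f \<circ> f = id" "f \<circ> (iv f \<circ> g) = g" "iv f \<circ> (f \<circ> g) = g"
  using Gamma_bij[OF assms] by (auto simp: fun_eq_iff bij_is_surj bij_is_inj surj_f_inv_f)

lemma Gamma_inv_inv [simp]: "f \<in> \<Gamma> \<Longrightarrow> iv (iv f) = f"
  by (simp add: Gamma_bij inv_inv_eq)

lemma Gamma_inv_comp [simp]: "f \<in> \<Gamma> \<Longrightarrow> g \<in> \<Gamma> \<Longrightarrow> iv (f \<circ> g) = iv g \<circ> iv f"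
  by (simp add: Gamma_bij o_inv_distrib)

lemma gen_squares [simp]:
  "gen_a \<circ> gen_a = id" "gen_b \<circ> gen_b = id" "gen_c \<circ> gen_c = id" "gen_d \<circ> gen_d = id"
  "gen_a \<circ> (gen_a \<circ> f) = f" "gen_b \<circ> (gen_b \<circ> f) = f" "gen_c \<circ> (gen_c \<circ> f) = f"
  "gen_d \<circ> (gen_d \<circ> f) = f"
  by (auto simp: fun_eq_iff gen_a_invol gen_bcd_invol)

lemma inv_gens [simp]: "iv gen_a = gen_a" "iv gen_b = gen_b" "iv gen_c = gen_c" "iv gen_d = gen_d"
  by (auto intro!: inv_unique_comp)

text \<open>The generators are involutions, so every element is a product of generators alone and
  left multiplication by them reaches all of \<open>\<Gamma>\<close> from \<open>id\<close>.\<close>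

lemma Gamma_induct [consumes 1, case_names id a b c d]:
  assumes "f \<in> \<Gamma>" and "P id"
    and "\<And>f. f \<in> \<Gamma> \<Longrightarrow> P f \<Longrightarrow> P (gen_a \<circ> f)" and "\<And>f. f \<in> \<Gamma> \<Longrightarrow> P f \<Longrightarrow> P (gen_b \<circ> f)"
    and "\<And>f. f \<in> \<Gamma> \<Longrightarrow> P f \<Longrightarrow> P (gen_c \<circ> f)" and "\<And>f. f \<in> \<Gamma> \<Longrightarrow> P f \<Longrightarrow> P (gen_d \<circ> f)"
  shows "P f"
proof -
  have invs: "inv\<^bsub>tree_Aut\<^esub> s = s" if "s \<in> {gen_a, gen_b, gen_c, gen_d}" for s
  proof -
    have "s \<in> carrier tree_Aut" using that generators_in_tree_Aut by blast
    moreover have "s \<otimes>\<^bsub>tree_Aut\<^esub> s = \<one>\<^bsub>tree_Aut\<^esub>" using that by (auto simp: tree_Aut_def)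
    ultimately show ?thesis by (metis group.inv_equality group_tree_Aut)
  qed
  \<comment> \<open>Strengthening to "left multiplication by \<open>f\<close> preserves
    \<open>P\<close>" makes the product case of \<open>generate.induct\<close> a composition of two
    hypotheses.\<close>
  have "\<forall>g\<in>\<Gamma>. P g \<longrightarrow> P (f \<circ> g)" if "f \<in> generate tree_Aut {gen_a, gen_b, gen_c, gen_d}" for f
    using that
  proof (induction rule: generate.induct)
    case one
    then show ?case by (simp add: one_tree_Aut)
  next
    case (incl h)
    then show ?case using assms(3-) by blast
  next
    case (inv h)
    then show ?case using assms(3-) invs[OF inv] by (simp only:) blast
  next
    case (eng h1 h2)
    then have "h2 \<in> \<Gamma>" by (simp add: Grigorchuk_def)
    then show ?case using eng by (simp only: mult_tree_Aut comp_assoc) (blast intro: Gamma_comp)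
  qed
  moreover have "f \<in> generate tree_Aut {gen_a, gen_b, gen_c, gen_d}"
    using assms(1) by (simp add: Grigorchuk_def)
  ultimately show ?thesis using assms(2) by (metis Gamma_id comp_id)
qed

text \<open>Wreath recursion: \<open>x\<close> and \<open>y\<close> are the sections at the vertices
  0 and 1, and \<open>e\<close> tells whether the two subtrees are swapped. Sections are indexed by
  the source vertex, whence the case distinction on the right factor in
  \<open>node_comp\<close>.\<close>

fun node :: "bool \<Rightarrow> (word \<Rightarrow> word) \<Rightarrow> (word \<Rightarrow> word) \<Rightarrow> word \<Rightarrow> word" where
  "node e x y [] = []"
| "node e x y (False # s) = e # x s"
| "node e x y (True # s) = (\<not> e) # y s"

lemma word_fun_eq_iff:
  fixes f g :: "word \<Rightarrow> 'a"
  shows "f = g \<longleftrightarrow> f [] = g [] \<and> (\<forall>s. f (False # s) = g (False # s)) \<and> (\<forall>s. f (True # s) = g (True # s))"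
proof (intro iffI ext)
  fix w assume "f [] = g [] \<and> (\<forall>s. f (False # s) = g (False # s)) \<and> (\<forall>s. f (True # s) = g (True # s))"
  then show "f w = g w" by (cases w rule: gen_a.cases) auto
qed simp

lemma node_comp [simp]:
  "node e x y \<circ> node e' x' y' =
     node (e \<noteq> e') (if e' then y \<circ> x' else x \<circ> x') (if e' then x \<circ> y' else y \<circ> y')"
  by (cases e'; cases e) (simp_all add: word_fun_eq_iff[of "_ \<circ> _"])

lemma node_comp_assoc [simp]:
  "node e x y \<circ> (node e' x' y' \<circ> g) =
     node (e \<noteq> e') (if e' then y \<circ> x' else x \<circ> x') (if e' then x \<circ> y' else y \<circ> y') \<circ> g"
  by (metis comp_assoc node_comp)

lemma node_eq_iff [simp]: "node e x y = node e' x' y' \<longleftrightarrow> e = e' \<and> x = x' \<and> y = y'"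
  by (subst word_fun_eq_iff) (auto simp: fun_eq_iff)

lemma node_id [simp]: "node False id id = id"
  by (simp add: word_fun_eq_iff)

lemma node_eq_id_iff [simp]:
  "node e x y = id \<longleftrightarrow> \<not> e \<and> x = id \<and> y = id"
  "id = node e x y \<longleftrightarrow> \<not> e \<and> x = id \<and> y = id"
  by (metis node_eq_iff node_id)+

lemma gen_a_node: "gen_a = node True id id"
  and gen_b_node: "gen_b = node False gen_a gen_c"
  and gen_c_node: "gen_c = node False gen_a gen_d"
  and gen_d_node: "gen_d = node False id gen_b"
  by (simp_all add: word_fun_eq_iff)

lemma Gamma_node:
  assumes "f \<in> \<Gamma>"
  shows "\<exists>e x y. x \<in> \<Gamma> \<and> y \<in> \<Gamma> \<and> f = node e x y"
proof -
  have comp: "\<exists>e x y. x \<in> \<Gamma> \<and> y \<in> \<Gamma> \<and> s \<circ> f = node e x y"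
    if f: "\<exists>e x y. x \<in> \<Gamma> \<and> y \<in> \<Gamma> \<and> f = node e x y" and s: "s = node e' p q" "p \<in> \<Gamma>" "q \<in> \<Gamma>" for f s e' p q
  proof -
    obtain e x y where xy: "x \<in> \<Gamma>" "y \<in> \<Gamma>" "f = node e x y" using f by blast
    have "(if e then q \<circ> x else p \<circ> x) \<in> \<Gamma>" "(if e then p \<circ> y else q \<circ> y) \<in> \<Gamma>"
      using xy s by auto
    then show ?thesis unfolding s xy node_comp by blast
  qed
  show ?thesis
    using assms
  proof (induction rule: Gamma_induct)
    case id
    show ?case using node_id[symmetric] Gamma_id by blast
  qed (rule comp, assumption, rule gen_a_node gen_b_node gen_c_node gen_d_node, simp, simp)+
qed

lemma Gamma_cases [consumes 1]:
  assumes "f \<in> \<Gamma>"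
  obtains e x y where "x \<in> \<Gamma>" "y \<in> \<Gamma>" "f = node e x y"
  using Gamma_node[OF assms] by blast

lemma node_in_Gamma: "node e x y \<in> \<Gamma> \<Longrightarrow> x \<in> \<Gamma> \<and> y \<in> \<Gamma>"
  by (erule Gamma_cases) simp

lemma iv_node [simp]:
  assumes "x \<in> \<Gamma>" "y \<in> \<Gamma>"
  shows "iv (node e x y) = (if e then node True (iv y) (iv x) else node False (iv x) (iv y))"
  by (rule inv_unique_comp) (use assms in simp_all)

lemma Gamma_length: "f \<in> \<Gamma> \<Longrightarrow> length (f w) = length w"
proof (induction w arbitrary: f)
  case (Cons i w)
  obtain e x y where "x \<in> \<Gamma>" "y \<in> \<Gamma>" "f = node e x y" using Cons.prems by (rule Gamma_cases)
  then show ?case using Cons.IH by (cases i) simp_all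
next
  case Nil
  then show ?case by (rule Gamma_cases) simp
qed

text \<open>The relations \<open>bc = d\<close>, \<open>cd = b\<close>, \<open>db = c\<close> are
  proved together by induction on words: at 0 they hold because \<open>a\<close> is an involution,
  and at 1 each one turns into the next in this cycle.\<close>

lemma klein [simp]:
  "gen_b \<circ> gen_c = gen_d" "gen_c \<circ> gen_b = gen_d" "gen_b \<circ> gen_d = gen_c"
  "gen_d \<circ> gen_b = gen_c" "gen_c \<circ> gen_d = gen_b" "gen_d \<circ> gen_c = gen_b"
proof -
  have "gen_b (gen_c w) = gen_d w \<and> gen_c (gen_d w) = gen_b w \<and> gen_d (gen_b w) = gen_c w" for w
  proof (induction w)
    case (Cons i w)
    then show ?case by (cases i) (simp_all add: gen_a_invol)
  qed simp
  then have *: "gen_b \<circ> gen_c = gen_d" "gen_c \<circ> gen_d = gen_b" "gen_d \<circ> gen_b = gen_c"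
    by (auto simp: fun_eq_iff)
  then show "gen_b \<circ> gen_c = gen_d" "gen_c \<circ> gen_d = gen_b" "gen_d \<circ> gen_b = gen_c" .
  show "gen_c \<circ> gen_b = gen_d" "gen_b \<circ> gen_d = gen_c" "gen_d \<circ> gen_c = gen_b"
    using *[symmetric] by (metis gen_squares(2-4,6-8) comp_assoc comp_id)+
qed

lemma klein_assoc [simp]:
  "gen_b \<circ> (gen_c \<circ> f) = gen_d \<circ> f" "gen_c \<circ> (gen_b \<circ> f) = gen_d \<circ> f"
  "gen_b \<circ> (gen_d \<circ> f) = gen_c \<circ> f" "gen_d \<circ> (gen_b \<circ> f) = gen_c \<circ> f"
  "gen_c \<circ> (gen_d \<circ> f) = gen_b \<circ> f" "gen_d \<circ> (gen_c \<circ> f) = gen_b \<circ> f"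
  by (metis klein comp_assoc)+

text \<open>Both projections of the first level stabilizer are onto \<open>\<Gamma>\<close>: at the
  vertex 1 the generators \<open>a\<close>, \<open>b\<close>, \<open>c\<close>, \<open>d\<close> are
  the sections of \<open>aca\<close>, \<open>d\<close>, \<open>b\<close>, \<open>c\<close>.
  Conjugation by \<open>a\<close> exchanges the two projections.\<close>

lemma Gamma_lift:
  assumes "y \<in> \<Gamma>"
  shows "\<exists>x. node False x y \<in> \<Gamma>" and "\<exists>x. node False y x \<in> \<Gamma>"
proof -
  show *: "\<exists>x. node False x y \<in> \<Gamma>"
    using assms
  proof (induction rule: Gamma_induct)
    case id
    then show ?case using Gamma_id node_id by metis
  next
    case (a f)
    then obtain x where x: "node False x f \<in> \<Gamma>" by blast
    have "node False (gen_d \<circ> x) (gen_a \<circ> f) = gen_a \<circ> gen_c \<circ> gen_a \<circ> node False x f"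
      by (simp add: gen_a_node gen_c_node comp_assoc)
    with x show ?case by (metis Gamma_comp Gamma_gens)
  next
    case (b f)
    then obtain x where x: "node False x f \<in> \<Gamma>" by blast
    have "node False x (gen_b \<circ> f) = gen_d \<circ> node False x f"
      by (simp add: gen_d_node)
    with x show ?case by (metis Gamma_comp Gamma_gens)
  next
    case (c f)
    then obtain x where x: "node False x f \<in> \<Gamma>" by blast
    have "node False (gen_a \<circ> x) (gen_c \<circ> f) = gen_b \<circ> node False x f"
      by (simp add: gen_b_node)
    with x show ?case by (metis Gamma_comp Gamma_gens)
  next
    case (d f)
    then obtain x where x: "node False x f \<in> \<Gamma>" by blast
    have "node False (gen_a \<circ> x) (gen_d \<circ> f) = gen_c \<circ> node False x f"
      by (simp add: gen_c_node)
    with x show ?case by (metis Gamma_comp Gamma_gens)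
  qed
  then obtain x where x: "node False x y \<in> \<Gamma>" by blast
  have "node False y x = gen_a \<circ> node False x y \<circ> gen_a"
    by (simp add: gen_a_node)
  with x show "\<exists>x. node False y x \<in> \<Gamma>" by (metis Gamma_comp Gamma_gens(1))
qed

lemma node_swap: "gen_a \<circ> node e x y \<circ> gen_a = node e y x"
  by (simp add: gen_a_node)

section \<open>The branching subgroup\<close>

definition normal_set :: "(word \<Rightarrow> word) set \<Rightarrow> bool" where
  "normal_set N \<longleftrightarrow> N \<subseteq> \<Gamma> \<and> id \<in> N \<and> (\<forall>f\<in>N. \<forall>g\<in>N. f \<circ> g \<in> N) \<and> (\<forall>f\<in>N. iv f \<in> N)
     \<and> (\<forall>u\<in>\<Gamma>. \<forall>f\<in>N. u \<circ> f \<circ> iv u \<in> N)"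

lemma normal_setI:
  assumes "N \<subseteq> \<Gamma>" "id \<in> N" "\<And>f g. f \<in> N \<Longrightarrow> g \<in> N \<Longrightarrow> f \<circ> g \<in> N" "\<And>f. f \<in> N \<Longrightarrow> iv f \<in> N"
    "\<And>u f. u \<in> \<Gamma> \<Longrightarrow> f \<in> N \<Longrightarrow> u \<circ> f \<circ> iv u \<in> N"
  shows "normal_set N"
  using assms unfolding normal_set_def by blast

lemma normal_setD:
  assumes "normal_set N"
  shows "f \<in> N \<Longrightarrow> f \<in> \<Gamma>" "id \<in> N" "f \<in> N \<Longrightarrow> g \<in> N \<Longrightarrow> f \<circ> g \<in> N" "f \<in> N \<Longrightarrow> iv f \<in> N"
    "u \<in> \<Gamma> \<Longrightarrow> f \<in> N \<Longrightarrow> u \<circ> f \<circ> iv u \<in> N"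
  using assms unfolding normal_set_def by blast+

lemma normal_set_conj':
  assumes "normal_set N" "u \<in> \<Gamma>" "f \<in> N"
  shows "iv u \<circ> f \<circ> u \<in> N"
  using normal_setD(5)[OF assms(1) Gamma_inv[OF assms(2)] assms(3)] assms(2) by simp

lemma normal_set_Gamma: "normal_set \<Gamma>"
  by (rule normal_setI) auto

lemma normal_set_swap:
  assumes "normal_set N" "node e x y \<in> N"
  shows "node e y x \<in> N"
  using normal_setD(5)[OF assms(1) Gamma_gens(1) assms(2)] by (simp add: node_swap)

text \<open>Any \<open>u\<close> lifts to some \<open>node False v u\<close> in
  \<open>\<Gamma>\<close>, and conjugating \<open>node False id f\<close> by it conjugates
  \<open>f\<close> by \<open>u\<close>, since \<open>v\<close> meets only the identity. Together
  with \<open>K0_least\<close> this reduces claims about sections in \<open>K0\<close> to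
  \<open>gen_t\<close>.\<close>

lemma normal_set_sect:
  assumes N: "normal_set N"
  shows "normal_set {x \<in> \<Gamma>. node False id x \<in> N}"
proof (rule normal_setI)
  fix f g assume "f \<in> {x \<in> \<Gamma>. node False id x \<in> N}" "g \<in> {x \<in> \<Gamma>. node False id x \<in> N}"
  then show "f \<circ> g \<in> {x \<in> \<Gamma>. node False id x \<in> N}"
    using normal_setD(3)[OF N, of "node False id f" "node False id g"] by simp
next
  fix f assume "f \<in> {x \<in> \<Gamma>. node False id x \<in> N}"
  then show "iv f \<in> {x \<in> \<Gamma>. node False id x \<in> N}"
    using normal_setD(4)[OF N, of "node False id f"] by simp
next
  fix u f assume u: "u \<in> \<Gamma>" and f: "f \<in> {x \<in> \<Gamma>. node False id x \<in> N}"
  obtain v where v: "node False v u \<in> \<Gamma>" using Gamma_lift[OF u] by blast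
  then have "v \<in> \<Gamma>" using node_in_Gamma by blast
  then show "u \<circ> f \<circ> iv u \<in> {x \<in> \<Gamma>. node False id x \<in> N}"
    using normal_setD(5)[OF N v, of "node False id f"] u f by simp
qed (use normal_setD[OF N] in auto)

text \<open>The commutator of \<open>a\<close> and \<open>b\<close>, since both are
  involutions.\<close>

definition gen_t :: "word \<Rightarrow> word" where
  "gen_t = gen_a \<circ> gen_b \<circ> gen_a \<circ> gen_b"

text \<open>\<open>\<Gamma>\<close> is a regular branch group over \<open>K0\<close>, and \<open>KK m\<close> below is the product of the copies of \<open>K0\<close> on
  the subtrees at level \<open>m\<close>.\<close>

definition K0 :: "(word \<Rightarrow> word) set" where
  "K0 = \<Inter> {N. normal_set N \<and> gen_t \<in> N}"

lemma gen_t_Gamma [simp]: "gen_t \<in> \<Gamma>"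
  by (simp add: gen_t_def)

lemma K0_least: "normal_set N \<Longrightarrow> gen_t \<in> N \<Longrightarrow> K0 \<subseteq> N"
  by (auto simp: K0_def)

lemma gen_t_K0: "gen_t \<in> K0"
  by (auto simp: K0_def)

lemma normal_set_K0: "normal_set K0"
proof (rule normal_setI)
  show "K0 \<subseteq> \<Gamma>" using K0_least[OF normal_set_Gamma] by simp
qed (auto simp: K0_def dest: normal_setD)

lemma gen_t_node: "gen_t = node False (gen_c \<circ> gen_a) (gen_a \<circ> gen_c)"
proof -
  have "gen_a \<circ> gen_b = node True gen_a gen_c"
    by (simp add: gen_a_node gen_b_node)
  then show ?thesis by (simp add: gen_t_def comp_assoc flip: gen_a_node)
qed

text \<open>This conjugate of \<open>d\<close> acts on the subtree at 0 only, whereas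
  \<open>d\<close> acts on that at 1; so the two commute.\<close>

definition gen_e :: "word \<Rightarrow> word" where
  "gen_e = gen_a \<circ> gen_d \<circ> gen_a"

lemma gen_e_node: "gen_e = node False gen_b id"
  by (simp add: gen_e_def gen_a_node gen_d_node)

lemma gen_e_Gamma [simp]: "gen_e \<in> \<Gamma>"
  by (simp add: gen_e_def)

lemma gen_e_d: "gen_e \<circ> gen_d = gen_d \<circ> gen_e"
  by (simp add: gen_e_node gen_d_node)

lemma gen_e_square [simp]: "gen_e \<circ> gen_e = id" "gen_e \<circ> (gen_e \<circ> f) = f"
  by (simp_all add: gen_e_def comp_assoc)

lemma inv_gen_e [simp]: "iv gen_e = gen_e"
  by (rule inv_unique_comp) simp_all

text \<open>This is \<open>[aca, d]\<close>, and \<open>a\<close>, \<open>b\<close> commute modulo \<open>K0\<close>.\<close>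

lemma sect_gen_t_K0: "node False id gen_t \<in> K0"
proof -
  have 1: "node False id gen_t = gen_a \<circ> gen_c \<circ> gen_a \<circ> gen_d \<circ> gen_a \<circ> gen_c \<circ> gen_a \<circ> gen_d"
  proof -
    have aca: "gen_a \<circ> gen_c \<circ> gen_a = node False gen_d gen_a"
      by (simp add: gen_a_node gen_c_node)
    have "gen_a \<circ> gen_c \<circ> gen_a \<circ> gen_d \<circ> gen_a \<circ> gen_c \<circ> gen_a \<circ> gen_d
      = (gen_a \<circ> gen_c \<circ> gen_a) \<circ> gen_d \<circ> ((gen_a \<circ> gen_c \<circ> gen_a) \<circ> gen_d)"
      by (simp add: comp_assoc)
    also have "\<dots> = node False id gen_t"
      unfolding aca by (simp add: gen_d_node gen_t_def comp_assoc)
    finally show ?thesis ..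
  qed
  have 2: "gen_a \<circ> gen_c \<circ> gen_a = gen_t \<circ> gen_b \<circ> gen_e"
    by (simp add: gen_t_def gen_e_def comp_assoc)
  have "node False id gen_t = (gen_t \<circ> gen_b \<circ> gen_e) \<circ> gen_d \<circ> iv (gen_t \<circ> gen_b \<circ> gen_e) \<circ> gen_d"
    unfolding 2[symmetric] 1 by (simp add: comp_assoc)
  also have "\<dots> = gen_t \<circ> (gen_b \<circ> (gen_e \<circ> gen_d) \<circ> (gen_e \<circ> (gen_b \<circ> (iv gen_t \<circ> gen_d))))"
    by (simp add: comp_assoc)
  also have "\<dots> = gen_t \<circ> (gen_d \<circ> iv gen_t \<circ> gen_d)"
    unfolding gen_e_d by (simp add: comp_assoc)
  also have "\<dots> \<in> K0"
    using normal_setD(5)[OF normal_set_K0 Gamma_gens(4) normal_setD(4)[OF normal_set_K0 gen_t_K0]] normal_setD(3)[OF normal_set_K0] gen_t_K0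
    by simp
  finally show ?thesis .
qed

text \<open>The elements whose copy at the vertex 1 lies in \<open>K0\<close> form a normal subgroup
  containing \<open>gen_t\<close>, hence all of \<open>K0\<close>. This is the branching
  property.\<close>

lemma sect_K0: "x \<in> K0 \<Longrightarrow> node False id x \<in> K0" "x \<in> K0 \<Longrightarrow> node False x id \<in> K0"
proof -
  have *: "K0 \<subseteq> {x \<in> \<Gamma>. node False id x \<in> K0}"
    by (intro K0_least normal_set_sect normal_set_K0) (simp add: sect_gen_t_K0)
  show "x \<in> K0 \<Longrightarrow> node False id x \<in> K0" using * by blast
  then show "x \<in> K0 \<Longrightarrow> node False x id \<in> K0" using normal_set_swap[OF normal_set_K0] by blast
qed

fun KK :: "nat \<Rightarrow> (word \<Rightarrow> word) set" where
  "KK 0 = K0"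
| "KK (Suc m) = {node False x y | x y. x \<in> KK m \<and> y \<in> KK m}"

declare KK.simps(2) [simp del]

lemma node_KK_Suc [simp]: "node e x y \<in> KK (Suc m) \<longleftrightarrow> \<not> e \<and> x \<in> KK m \<and> y \<in> KK m"
  by (auto simp: KK.simps(2))

lemma KKSE:
  assumes "f \<in> KK (Suc m)"
  obtains x y where "x \<in> KK m" "y \<in> KK m" "f = node False x y"
  using assms by (auto simp: KK.simps(2))

lemma KK_Suc_subset: "KK (Suc m) \<subseteq> KK m"
proof (induction m)
  case 0
  have "node False x y \<in> K0" if "x \<in> K0" "y \<in> K0" for x y
    using normal_setD(3)[OF normal_set_K0 sect_K0(2)[OF that(1)] sect_K0(1)[OF that(2)]] by simp
  then show ?case by (auto elim: KKSE)
next
  case (Suc m)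
  then show ?case by (auto elim!: KKSE[of _ "Suc m"])
qed

lemma KK_mono: "m \<le> n \<Longrightarrow> KK n \<subseteq> KK m"
  by (rule lift_Suc_antimono_le[of KK]) (rule KK_Suc_subset)

lemma KK_Gamma: "x \<in> KK m \<Longrightarrow> x \<in> \<Gamma>"
  using KK_mono[of 0 m] normal_setD(1)[OF normal_set_K0] by auto

lemma normal_set_KK: "normal_set (KK m)"
proof (induction m)
  case (Suc m)
  note IH = normal_setD[OF Suc.IH]
  show ?case
  proof (rule normal_setI)
    fix f g assume "f \<in> KK (Suc m)" "g \<in> KK (Suc m)"
    then show "f \<circ> g \<in> KK (Suc m)" by (elim KKSE) (simp add: IH(3))
  next
    show "KK (Suc m) \<subseteq> \<Gamma>" using KK_Gamma by blast
    have "node False id id \<in> KK (Suc m)" unfolding node_KK_Suc by (simp add: IH(2))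
    then show "id \<in> KK (Suc m)" by (simp only: node_id)
  next
    fix f assume "f \<in> KK (Suc m)"
    then show "iv f \<in> KK (Suc m)" by (elim KKSE) (simp add: KK_Gamma IH(4))
  next
    fix u f assume u: "u \<in> \<Gamma>" and f: "f \<in> KK (Suc m)"
    obtain e x y where xy: "x \<in> \<Gamma>" "y \<in> \<Gamma>" "u = node e x y" using u by (rule Gamma_cases)
    obtain p q where pq: "p \<in> KK m" "q \<in> KK m" "f = node False p q" using f by (rule KKSE)
    then have "p \<in> \<Gamma>" "q \<in> \<Gamma>" by (simp_all add: KK_Gamma)
    then show "u \<circ> f \<circ> iv u \<in> KK (Suc m)"
      unfolding xy pq using xy pq by (simp add: IH(5))
  qed
qed (simp add: normal_set_K0)

text \<open>Induction leaves eta-expanded functions in the goals, on which these rules would unfold compositions.\<close>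

declare o_apply [simp del] id_apply [simp del]

section \<open>The congruence subgroup property\<close>

text \<open>The copy of \<open>x\<close> on the subtree below \<open>v\<close>, trivial elsewhere.
  By branching it lies in \<open>K0\<close> whenever \<open>x\<close> does.\<close>

fun put_at :: "word \<Rightarrow> (word \<Rightarrow> word) \<Rightarrow> word \<Rightarrow> word" where
  "put_at [] x = x"
| "put_at (False # v) x = node False (put_at v x) id"
| "put_at (True # v) x = node False id (put_at v x)"

lemma put_at_comp [simp]: "put_at v x \<circ> put_at v y = put_at v (x \<circ> y)"
proof (induction v)
  case (Cons i v)
  then show ?case by (cases i) simp_all
qed simp

lemma put_at_id [simp]: "put_at v id = id"
proof (induction v)
  case (Cons i v)
  then show ?case by (cases i) simp_all
qed simp

lemma put_at_append: "put_at (v @ w) x = put_at v (put_at w x)"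
proof (induction v)
  case (Cons i v)
  then show ?case by (cases i) simp_all
qed simp

lemma K0_Gamma [simp]: "x \<in> K0 \<Longrightarrow> x \<in> \<Gamma>"
  using normal_setD(1)[OF normal_set_K0] .

lemma put_at_K0: "x \<in> K0 \<Longrightarrow> put_at v x \<in> K0"
proof (induction v)
  case (Cons i v)
  then show ?case by (cases i) (simp_all add: sect_K0)
qed simp

lemma iv_put_at: "x \<in> K0 \<Longrightarrow> iv (put_at v x) = put_at v (iv x)"
  by (rule inv_unique_comp) simp_all

text \<open>Distinct vertices of one level have disjoint subtrees.\<close>

lemma put_at_disjoint:
  "length v = length w \<Longrightarrow> v \<noteq> w \<Longrightarrow> put_at v x \<circ> put_at w y = put_at w y \<circ> put_at v x"
proof (induction v w rule: list_induct2)
  case (Cons i v j w)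
  then show ?case by (cases i; cases j) auto
qed simp

text \<open>Conjugation by \<open>g\<close> carries the support from below \<open>v\<close> to below
  \<open>g v\<close>; \<open>z\<close> is the conjugate of \<open>x\<close> by the section of
  \<open>g\<close> at \<open>v\<close>.\<close>

lemma put_at_conj:
  "g \<in> \<Gamma> \<Longrightarrow> \<exists>z. g \<circ> put_at v x \<circ> iv g = put_at (g v) z"
proof (induction v arbitrary: g)
  case Nil
  have "g [] = []" using Gamma_length[OF Nil, of "[]"] by simp
  then show ?case by simp
next
  case (Cons i v)
  obtain e p q where g: "p \<in> \<Gamma>" "q \<in> \<Gamma>" "g = node e p q" using Cons.prems by (rule Gamma_cases)
  obtain z where "p \<circ> put_at v x \<circ> iv p = put_at (p v) z" using Cons.IH[OF g(1)] by blast
  moreover obtain z' where "q \<circ> put_at v x \<circ> iv q = put_at (q v) z'" using Cons.IH[OF g(2)] by blast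
  ultimately show ?case using g(1,2) unfolding g(3)
    by (cases i; cases e) (auto intro: exI[of _ z] exI[of _ z'])
qed

text \<open>Descend along \<open>v\<close>: the normal subgroup of elements whose copy at 1 lies in
  \<open>N\<close> contains the copy of \<open>gen_t\<close> at the remaining path. Swapping the
  subtrees by \<open>a\<close> makes the first letter of \<open>v\<close> irrelevant and yields both
  factors of the product.\<close>

lemma KK_subset:
  "normal_set N \<Longrightarrow> put_at v gen_t \<in> N \<Longrightarrow> KK (length v) \<subseteq> N"
proof (induction v arbitrary: N)
  case Nil
  then show ?case by (simp add: K0_least)
next
  case (Cons i v)
  let ?N = "{x \<in> \<Gamma>. node False id x \<in> N}"
  have "node False id (put_at v gen_t) \<in> N"
    using Cons.prems(2) normal_set_swap[OF Cons.prems(1)] by (cases i) auto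
  then have "put_at v gen_t \<in> ?N" by (simp add: put_at_K0 gen_t_K0)
  then have *: "KK (length v) \<subseteq> ?N" using Cons.IH normal_set_sect[OF Cons.prems(1)] by blast
  have "node False x y \<in> N" if "x \<in> KK (length v)" "y \<in> KK (length v)" for x y
  proof -
    have "node False x id \<in> N" "node False id y \<in> N"
      using that * normal_set_swap[OF Cons.prems(1)] by blast+
    from normal_setD(3)[OF Cons.prems(1) this] show ?thesis by simp
  qed
  then show ?case by (auto elim: KKSE)
qed

text \<open>The section of \<open>gen_t\<close> at 0 is \<open>ca\<close>, so this is the only
  nontrivial section of the commutator of \<open>gen_t\<close> with
  \<open>node False gen_t id\<close>.\<close>

lemma commutator_ca_t: "(gen_c \<circ> gen_a) \<circ> gen_t \<circ> iv (gen_c \<circ> gen_a) \<circ> iv gen_t = node False id (iv gen_t)"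
proof -
  have aa: "gen_a \<circ> gen_t \<circ> gen_a = node False (gen_a \<circ> gen_c) (gen_c \<circ> gen_a)"
    unfolding gen_t_node by (rule node_swap)
  have cc: "gen_c \<circ> node False x y \<circ> gen_c = node False (gen_a \<circ> x \<circ> gen_a) (gen_d \<circ> y \<circ> gen_d)" for x y
    by (simp add: gen_c_node comp_assoc)
  have iv: "iv gen_t = node False (gen_a \<circ> gen_c) (gen_c \<circ> gen_a)"
    unfolding gen_t_node by simp
  have "(gen_c \<circ> gen_a) \<circ> gen_t \<circ> iv (gen_c \<circ> gen_a) \<circ> iv gen_t
    = (gen_c \<circ> (gen_a \<circ> gen_t \<circ> gen_a) \<circ> gen_c) \<circ> iv gen_t"
    by (simp add: comp_assoc)
  also have "\<dots> = node False id (gen_b \<circ> (gen_a \<circ> (gen_b \<circ> gen_a)))"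
    unfolding aa cc iv by (simp add: comp_assoc)
  finally show ?thesis by (simp add: gen_t_def)
qed

text \<open>Double commutator argument: if \<open>g\<close> moves \<open>v\<close> and
  \<open>P\<close>, \<open>Y\<close> are supported below \<open>v\<close>, then
  \<open>[g, P]\<close> lies in \<open>N\<close> and is \<open>P^-1\<close> times a factor supported
  below \<open>g v\<close>. That factor commutes with \<open>P\<close> and \<open>Y\<close>, so
  \<open>[[g, P], Y] = [P^-1, Y]\<close> is an element of \<open>N\<close> supported below
  \<open>v\<close>.\<close>

lemma KK_subset_moving:
  assumes N: "normal_set N" and g: "g \<in> N" "g v \<noteq> v"
  shows "KK (length v + 2) \<subseteq> N"
proof -
  have gG: "g \<in> \<Gamma>" using g normal_setD(1)[OF N] by blast
  \<comment> \<open>By \<open>commutator_ca_t\<close>, the commutator of \<open>gen_t\<close> with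
    this element is \<open>iv gen_t\<close> placed at the path 01. This accounts for the two
    additional levels.\<close>
  let ?y = "node False gen_t id"
  obtain P Y where P_def: "P = put_at v (iv gen_t)" and Y_def: "Y = put_at v ?y" by blast
  have y: "?y \<in> K0" by (simp add: sect_K0 gen_t_K0)
  have G: "iv gen_t \<in> K0" by (simp add: normal_setD(4)[OF normal_set_K0] gen_t_K0)
  have PY: "P \<in> \<Gamma>" "Y \<in> \<Gamma>" using put_at_K0[OF G] put_at_K0[OF y] by (simp_all add: P_def Y_def)
  obtain z where z: "g \<circ> P \<circ> iv g = put_at (g v) z"
    using put_at_conj[OF gG] P_def by blast
  obtain Z where Z_def: "Z = g \<circ> P \<circ> iv g" by blast
  have ZG: "Z \<in> \<Gamma>" by (simp add: Z_def PY gG)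
  \<comment> \<open>This is \<open>g\<close> times the conjugate of \<open>iv g\<close> by
    \<open>P\<close>.\<close>
  have E: "Z \<circ> iv P \<in> N"
    using normal_setD(3)[OF N g(1) normal_setD(5)[OF N PY(1) normal_setD(4)[OF N g(1)]]] by (simp add: Z_def comp_assoc)
  have "(Z \<circ> iv P) \<circ> (Y \<circ> iv (Z \<circ> iv P) \<circ> iv Y) \<in> N"
    using normal_setD(3)[OF N E normal_setD(5)[OF N PY(2) normal_setD(4)[OF N E]]] .
  also have "(Z \<circ> iv P) \<circ> (Y \<circ> iv (Z \<circ> iv P) \<circ> iv Y) = Z \<circ> (iv P \<circ> Y \<circ> P) \<circ> iv Z \<circ> iv Y"
    by (simp add: comp_assoc PY ZG)
  also have "iv P \<circ> Y \<circ> P = put_at v (gen_t \<circ> ?y \<circ> iv gen_t)"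
    unfolding P_def Y_def by (simp add: iv_put_at[OF G])
  \<comment> \<open>\<open>Z\<close> lives below \<open>g v\<close>, a different vertex of the same
    level, so it moves past everything below \<open>v\<close> and cancels.\<close>
  also have "Z \<circ> put_at v (gen_t \<circ> ?y \<circ> iv gen_t) = put_at v (gen_t \<circ> ?y \<circ> iv gen_t) \<circ> Z"
    unfolding Z_def z by (rule put_at_disjoint) (use g Gamma_length[OF gG] in auto)
  also have "put_at v (gen_t \<circ> ?y \<circ> iv gen_t) \<circ> Z \<circ> iv Z \<circ> iv Y
    = put_at v (gen_t \<circ> ?y \<circ> iv gen_t \<circ> iv ?y)"
    unfolding Y_def iv_put_at[OF y] using ZG by (simp add: comp_assoc del: iv_node node_comp node_comp_assoc)
  also have "gen_t \<circ> ?y \<circ> iv gen_t \<circ> iv ?y = put_at [False, True] (iv gen_t)"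
    using commutator_ca_t by (subst (1 2) gen_t_node) (simp add: comp_assoc)
  also have "put_at v (put_at [False, True] (iv gen_t)) = iv (put_at (v @ [False, True]) gen_t)"
    by (simp only: put_at_append[symmetric] iv_put_at[OF gen_t_K0])
  finally have "put_at (v @ [False, True]) gen_t \<in> N"
    using normal_setD(4)[OF N, of "iv (put_at (v @ [False, True]) gen_t)"] put_at_K0[OF gen_t_K0] by simp
  then show ?thesis using KK_subset[OF N] by fastforce
qed

text \<open>Provides infinitely many distinct elements for a pigeonhole argument:
  \<open>gen_t\<close> has the nontrivial section \<open>ca\<close> at 0, while a copy placed deeper
  along the ray of ones has a trivial one.\<close>

lemma put_at_t_inj: "put_at (replicate n True) gen_t = put_at (replicate m True) gen_t \<Longrightarrow> n = m"
proof (induction n arbitrary: m)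
  case 0
  then show ?case
    by (cases m) (auto simp: gen_t_node gen_c_node gen_a_node)
next
  case (Suc n)
  then show ?case
    by (cases m) (auto simp: gen_t_node gen_c_node gen_a_node)
qed

text \<open>Infinitely many elements act on finitely many cosets of \<open>H\<close>, so two of them
  act equally and their quotient is a nontrivial element of the normal core of \<open>H\<close>. It
  moves some vertex, and \<open>KK_subset_moving\<close> applies to the core.\<close>

theorem congruence_subgroup:
  assumes H: "subgroup H Grigorchuk" and fin: "finite (rcosets\<^bsub>Grigorchuk\<^esub> H)"
  shows "\<exists>m. KK m \<subseteq> H"
proof -
  \<comment> \<open>The normal core of \<open>H\<close>.\<close>
  obtain N where N_def: "N = {x \<in> \<Gamma>. \<forall>y\<in>\<Gamma>. y \<circ> x \<circ> iv y \<in> H}" by blast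
  have Hc: "f \<circ> g \<in> H" if "f \<in> H" "g \<in> H" for f g
    using subgroup.m_closed[OF H that] by (simp add: mult_Grigorchuk)
  have Hi: "iv f \<in> H" if "f \<in> H" for f
    using subgroup.m_inv_closed[OF H that] m_inv_Grigorchuk subgroup.mem_carrier[OF H that] by simp
  have Hid: "id \<in> H"
    using subgroup.one_closed[OF H] by (simp add: one_Grigorchuk)
  have N: "normal_set N"
  proof (rule normal_setI)
    show "N \<subseteq> \<Gamma>" by (auto simp: N_def)
    show "id \<in> N" by (simp add: N_def Hid)
  next
    fix f g assume fg: "f \<in> N" "g \<in> N"
    have "y \<circ> (f \<circ> g) \<circ> iv y \<in> H" if y: "y \<in> \<Gamma>" for y
      using Hc[of "y \<circ> f \<circ> iv y" "y \<circ> g \<circ> iv y"] fg y by (simp add: N_def comp_assoc)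
    then show "f \<circ> g \<in> N" using fg by (simp add: N_def)
  next
    fix f assume f: "f \<in> N"
    have "y \<circ> iv f \<circ> iv y \<in> H" if y: "y \<in> \<Gamma>" for y
      using Hi[of "y \<circ> f \<circ> iv y"] f y by (simp add: N_def comp_assoc)
    then show "iv f \<in> N" using f by (simp add: N_def)
  next
    fix u f assume u: "u \<in> \<Gamma>" and f: "f \<in> N"
    have "y \<circ> (u \<circ> f \<circ> iv u) \<circ> iv y \<in> H" if y: "y \<in> \<Gamma>" for y
    proof -
      have "(y \<circ> u) \<circ> f \<circ> iv (y \<circ> u) \<in> H" using f u y by (simp only: N_def mem_Collect_eq) (blast intro: Gamma_comp)
      then show ?thesis using u y by (simp add: comp_assoc)
    qed
    then show "u \<circ> f \<circ> iv u \<in> N" using f u by (simp add: N_def)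
  qed
  let ?x = "\<lambda>n. put_at (replicate n True) gen_t"
  \<comment> \<open>The permutation of the right cosets given by the \<open>n\<close>-th element,
    restricted to an extensional function so that only finitely many are possible.\<close>
  let ?F = "\<lambda>n. \<lambda>C\<in>rcosets\<^bsub>Grigorchuk\<^esub> H. C #>\<^bsub>Grigorchuk\<^esub> ?x n"
  have xG: "?x n \<in> \<Gamma>" for n using put_at_K0[OF gen_t_K0] by simp
  interpret G: group Grigorchuk by (rule group_Grigorchuk)
  have "range ?F \<subseteq> (\<Pi>\<^sub>E C\<in>rcosets\<^bsub>Grigorchuk\<^esub> H. rcosets\<^bsub>Grigorchuk\<^esub> H)"
  proof (intro image_subsetI PiE_I)
    fix n C assume "C \<in> rcosets\<^bsub>Grigorchuk\<^esub> H"
    then obtain y where "y \<in> \<Gamma>" "C = H #>\<^bsub>Grigorchuk\<^esub> y" by (auto simp: RCOSETS_def)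
    then show "?F n C \<in> rcosets\<^bsub>Grigorchuk\<^esub> H" using \<open>C \<in> _\<close> xG[of n] subgroup.subset[OF H]
      by (simp add: G.coset_mult_assoc G.rcosetsI)
  qed simp
  then have "finite (range ?F)" using finite_PiE[OF fin, of "\<lambda>_. rcosets\<^bsub>Grigorchuk\<^esub> H"] fin
    by (meson finite_subset)
  then have "\<not> inj ?F" using finite_imageD infinite_UNIV_nat by blast
  then obtain n m where nm: "n \<noteq> m" "?F n = ?F m" unfolding inj_on_def by blast
  obtain g where g_def: "g = ?x n \<circ> iv (?x m)" by blast
  have gN: "g \<in> N"
  proof -
    have "y \<circ> g \<circ> iv y \<in> H" if y: "y \<in> \<Gamma>" for y
    proof -
      \<comment> \<open>Equality of the two actions on the coset of \<open>y\<close> is what puts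
        \<open>y \<circ> g \<circ> iv y\<close> into \<open>H\<close>.\<close>
      have C: "H #>\<^bsub>Grigorchuk\<^esub> y \<in> rcosets\<^bsub>Grigorchuk\<^esub> H" using G.rcosetsI[OF subgroup.subset[OF H] y] .
      have "H #>\<^bsub>Grigorchuk\<^esub> y #>\<^bsub>Grigorchuk\<^esub> ?x n = H #>\<^bsub>Grigorchuk\<^esub> y #>\<^bsub>Grigorchuk\<^esub> ?x m"
        using fun_cong[OF nm(2), of "H #>\<^bsub>Grigorchuk\<^esub> y"] C by simp
      then have "H #>\<^bsub>Grigorchuk\<^esub> (y \<circ> ?x n) = H #>\<^bsub>Grigorchuk\<^esub> (y \<circ> ?x m)"
        using y xG subgroup.subset[OF H] by (simp add: G.coset_mult_assoc mult_Grigorchuk)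
      moreover have "y \<circ> ?x n \<in> H #>\<^bsub>Grigorchuk\<^esub> (y \<circ> ?x n)"
        using Hid by (auto simp: r_coset_def mult_Grigorchuk intro!: bexI[of _ id])
      ultimately obtain h where h: "h \<in> H" "y \<circ> ?x n = h \<circ> (y \<circ> ?x m)"
        by (auto simp: r_coset_def mult_Grigorchuk)
      have "y \<circ> g \<circ> iv y = (y \<circ> ?x n) \<circ> (iv (?x m) \<circ> iv y)"
        by (simp add: g_def comp_assoc)
      also have "\<dots> = h"
        unfolding h(2) using y xG by (simp add: comp_assoc)
      finally show ?thesis using h(1) by simp
    qed
    then show ?thesis using xG by (simp add: N_def g_def)
  qed
  have "g \<noteq> id"
  proof
    assume "g = id"
    then have "?x n \<circ> iv (?x m) \<circ> ?x m = ?x m" by (simp add: g_def)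
    then have "?x n = ?x m" using xG by (simp add: comp_assoc)
    with put_at_t_inj nm(1) show False by blast
  qed
  then obtain v where "g v \<noteq> v" by (auto simp: fun_eq_iff id_apply)
  then have "KK (length v + 2) \<subseteq> N" using KK_subset_moving[OF N gN] by blast
  moreover have "N \<subseteq> H"
    unfolding N_def using Gamma_id by (force dest: bspec[of _ _ id])
  ultimately show ?thesis by blast
qed

section \<open>Finite quotients\<close>

definition congr :: "(word \<Rightarrow> word) \<Rightarrow> (word \<Rightarrow> word) \<Rightarrow> bool" where
  "congr f g \<longleftrightarrow> f \<in> \<Gamma> \<and> g \<in> \<Gamma> \<and> f \<circ> iv g \<in> K0"

lemma congrD: "congr f g \<Longrightarrow> f \<in> \<Gamma>" "congr f g \<Longrightarrow> g \<in> \<Gamma>"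
  by (auto simp: congr_def)

lemma congr_refl: "f \<in> \<Gamma> \<Longrightarrow> congr f f"
  by (simp add: congr_def normal_setD(2)[OF normal_set_K0])

lemma congr_sym: "congr f g \<Longrightarrow> congr g f"
  using normal_setD(4)[OF normal_set_K0, of "f \<circ> iv g"] by (simp add: congr_def)

lemma congr_trans [trans]: "congr f g \<Longrightarrow> congr g h \<Longrightarrow> congr f h"
  using normal_setD(3)[OF normal_set_K0, of "f \<circ> iv g" "g \<circ> iv h"] by (simp add: congr_def comp_assoc)

lemma congr_left:
  assumes "congr f g" "u \<in> \<Gamma>"
  shows "congr (u \<circ> f) (u \<circ> g)"
  using normal_setD(5)[OF normal_set_K0, of u "f \<circ> iv g"] assms by (simp add: congr_def comp_assoc)

lemma congr_right: "congr f g \<Longrightarrow> u \<in> \<Gamma> \<Longrightarrow> congr (f \<circ> u) (g \<circ> u)"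
  by (simp add: congr_def comp_assoc)

lemma congr_ba: "congr (gen_b \<circ> gen_a) (gen_a \<circ> gen_b)"
  using normal_setD(4)[OF normal_set_K0 gen_t_K0] by (simp add: congr_def gen_t_def comp_assoc)

text \<open>\<open>b\<close> commutes with \<open>d\<close>, and modulo \<open>K0\<close> with
  \<open>a\<close>; hence modulo \<open>K0\<close> with \<open>gen_e = ada\<close>.\<close>

lemma congr_be: "congr (gen_b \<circ> gen_e) (gen_e \<circ> gen_b)"
proof -
  have 1: "congr ((gen_b \<circ> gen_a) \<circ> (gen_d \<circ> gen_a)) ((gen_a \<circ> gen_b) \<circ> (gen_d \<circ> gen_a))"
    by (intro congr_right congr_ba) simp
  have 2: "congr ((gen_a \<circ> gen_d) \<circ> (gen_b \<circ> gen_a)) ((gen_a \<circ> gen_d) \<circ> (gen_a \<circ> gen_b))"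
    by (intro congr_left congr_ba) simp
  have 3: "(gen_a \<circ> gen_b) \<circ> (gen_d \<circ> gen_a) = (gen_a \<circ> gen_d) \<circ> (gen_b \<circ> gen_a)"
    by (simp add: comp_assoc)
  show ?thesis using congr_trans[OF 1[unfolded 3] 2] by (simp add: gen_e_def comp_assoc)
qed

text \<open>Representatives for the first level stabilizer modulo \<open>K0\<close>, selected so
  that they centralize \<open>d\<close> exactly and not just modulo \<open>K0\<close>.\<close>

definition reps :: "(word \<Rightarrow> word) set" where
  "reps = {x \<circ> y | x y. x \<in> {id, gen_e} \<and> y \<in> {id, gen_b, gen_c, gen_d}}"

lemma repsI: "x \<in> {id, gen_e} \<Longrightarrow> y \<in> {id, gen_b, gen_c, gen_d} \<Longrightarrow> x \<circ> y \<in> reps"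
  unfolding reps_def by blast

lemma repsE:
  assumes "r \<in> reps"
  obtains x y where "x \<in> {id, gen_e}" "y \<in> {id, gen_b, gen_c, gen_d}" "r = x \<circ> y"
  using assms unfolding reps_def by blast

lemma finite_reps: "finite reps"
  unfolding reps_def by (rule finite_image_set2) simp_all

lemma klein_closed:
  "x \<in> {id, gen_b, gen_c, gen_d} \<Longrightarrow> y \<in> {id, gen_b, gen_c, gen_d} \<Longrightarrow> x \<circ> y \<in> {id, gen_b, gen_c, gen_d}"
  by auto

lemma reps_Gamma: "r \<in> reps \<Longrightarrow> r \<in> \<Gamma>"
  by (erule repsE) auto

lemma reps_d: "r \<in> reps \<Longrightarrow> gen_d \<circ> r = r \<circ> gen_d"
proof -
  assume "r \<in> reps"
  then obtain x y where r: "r = x \<circ> y" "x \<in> {id, gen_e}" "y \<in> {id, gen_b, gen_c, gen_d}"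
    by (auto simp: reps_def)
  have "gen_d \<circ> x = x \<circ> gen_d" using r(2) gen_e_d by auto
  moreover have "gen_d \<circ> y = y \<circ> gen_d" using r(3) by auto
  ultimately show ?thesis unfolding r(1) by (simp only: comp_assoc[symmetric]) (simp only: comp_assoc)
qed

definition near_rep :: "(word \<Rightarrow> word) \<Rightarrow> bool" where
  "near_rep f \<longleftrightarrow> (\<exists>r\<in>reps. congr f r)"

lemma near_rep_cong: "near_rep f \<Longrightarrow> congr g f \<Longrightarrow> near_rep g"
  unfolding near_rep_def by (blast intro: congr_trans)

text \<open>A new factor \<open>b\<close> or \<open>d\<close> must be moved past a possible leading
  \<open>gen_e\<close>: \<open>d\<close> commutes with it and \<open>b\<close> does so modulo
  \<open>K0\<close>. The factor \<open>c\<close> is treated as \<open>b\<close> after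
  \<open>d\<close>.\<close>

lemma near_rep_mult:
  assumes "near_rep f"
  shows "near_rep (gen_b \<circ> f)" "near_rep (gen_c \<circ> f)" "near_rep (gen_d \<circ> f)" "near_rep (gen_e \<circ> f)"
proof -
  obtain x y where xy: "x \<in> {id, gen_e}" "y \<in> {id, gen_b, gen_c, gen_d}" "congr f (x \<circ> y)"
    using assms by (auto simp: near_rep_def reps_def)
  have G: "x \<in> \<Gamma>" "y \<in> \<Gamma>" using xy by auto
  have step: "near_rep (s \<circ> f)" if s: "s \<in> {gen_b, gen_d}" for s
  proof -
    have sG: "s \<in> \<Gamma>" using s by auto
    have "congr (s \<circ> f) (s \<circ> (x \<circ> y))" using xy(3) sG by (rule congr_left)
    also have "congr (s \<circ> x) (x \<circ> s)"
      using xy(1) s congr_be congr_refl[of "gen_d \<circ> gen_e"] congr_refl[OF sG] gen_e_d by auto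
    then have "congr ((s \<circ> x) \<circ> y) ((x \<circ> s) \<circ> y)" using G(2) by (rule congr_right)
    then have "congr (s \<circ> (x \<circ> y)) (x \<circ> (s \<circ> y))" by (simp only: comp_assoc)
    finally show ?thesis
      unfolding near_rep_def using repsI[OF xy(1) klein_closed[OF _ xy(2), of s]] s by auto
  qed
  show b: "near_rep (gen_b \<circ> f)" and d: "near_rep (gen_d \<circ> f)" using step by auto
  have "congr (gen_e \<circ> f) (gen_e \<circ> (x \<circ> y))" using xy(3) by (rule congr_left) simp
  moreover have "gen_e \<circ> (x \<circ> y) \<in> reps"
  proof -
    have "gen_e \<circ> x \<in> {id, gen_e}" using xy(1) by auto
    then show ?thesis using repsI[of "gen_e \<circ> x" y] xy(2) by (simp add: comp_assoc)
  qed
  ultimately show "near_rep (gen_e \<circ> f)" unfolding near_rep_def by blast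
  obtain x' y' where xy': "x' \<in> {id, gen_e}" "y' \<in> {id, gen_b, gen_c, gen_d}" "congr (gen_d \<circ> f) (x' \<circ> y')"
    using d by (auto simp: near_rep_def reps_def)
  have G': "x' \<in> \<Gamma>" "y' \<in> \<Gamma>" using xy' by auto
  have "congr (gen_b \<circ> (gen_d \<circ> f)) (gen_b \<circ> (x' \<circ> y'))" using xy'(3) by (rule congr_left) simp
  also have "congr (gen_b \<circ> x') (x' \<circ> gen_b)" using xy'(1) congr_be congr_refl[of gen_b] by auto
  then have "congr ((gen_b \<circ> x') \<circ> y') ((x' \<circ> gen_b) \<circ> y')" using G'(2) by (rule congr_right)
  then have "congr (gen_b \<circ> (x' \<circ> y')) (x' \<circ> (gen_b \<circ> y'))" by (simp only: comp_assoc)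
  finally have "congr (gen_c \<circ> f) (x' \<circ> (gen_b \<circ> y'))" by simp
  then show "near_rep (gen_c \<circ> f)"
    unfolding near_rep_def using repsI[OF xy'(1) klein_closed[OF _ xy'(2), of gen_b]] by auto
qed

text \<open>At most one leading \<open>a\<close> remains: modulo \<open>K0\<close> it passes
  \<open>b\<close>, and passing \<open>d\<close> turns it into \<open>gen_e\<close>;
  \<open>c\<close> is again \<open>bd\<close>.\<close>

lemma near_rep_cover:
  assumes "f \<in> \<Gamma>"
  shows "near_rep f \<or> near_rep (gen_a \<circ> f)"
proof -
  have step_b: "near_rep (gen_b \<circ> f) \<or> near_rep (gen_a \<circ> (gen_b \<circ> f))" if f: "f \<in> \<Gamma>" and n: "near_rep f \<or> near_rep (gen_a \<circ> f)" for f
  proof -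
    have "congr (gen_a \<circ> gen_b \<circ> f) (gen_b \<circ> gen_a \<circ> f)"
      using congr_right[OF congr_sym[OF congr_ba] f] .
    then have "congr (gen_a \<circ> (gen_b \<circ> f)) (gen_b \<circ> (gen_a \<circ> f))" by (simp only: comp_assoc)
    then show ?thesis using n near_rep_mult(1) near_rep_cong by blast
  qed
  have step_d: "near_rep (gen_d \<circ> f) \<or> near_rep (gen_a \<circ> (gen_d \<circ> f))" if "near_rep f \<or> near_rep (gen_a \<circ> f)" for f
  proof -
    have "gen_a \<circ> (gen_d \<circ> f) = gen_e \<circ> (gen_a \<circ> f)" by (simp add: gen_e_def comp_assoc)
    then show ?thesis using that near_rep_mult(3)[of f] near_rep_mult(4)[of "gen_a \<circ> f"] by auto
  qed
  show ?thesis
    using assms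
  proof (induction rule: Gamma_induct)
    case id
    have "congr id (id \<circ> id)" using congr_refl[of id] by simp
    then have "near_rep id" unfolding near_rep_def using repsI[of id id] by blast
    then show ?case ..
  next
    case (a f)
    then show ?case by auto
  next
    case (b f)
    then show ?case by (rule step_b)
  next
    case (c f)
    have "near_rep (gen_b \<circ> (gen_d \<circ> f)) \<or> near_rep (gen_a \<circ> (gen_b \<circ> (gen_d \<circ> f)))"
      using c step_d by (intro step_b) auto
    then show ?case by simp
  next
    case (d f)
    then show ?case using step_d by blast
  qed
qed

section \<open>The first level stabilizer modulo \<open>K0\<close>\<close>

definition St1 :: "(word \<Rightarrow> word) set" where
  "St1 = {f \<in> \<Gamma>. \<exists>x y. f = node False x y}"

lemma node_St1: "node e x y \<in> St1 \<longleftrightarrow> \<not> e \<and> node e x y \<in> \<Gamma>"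
  by (auto simp: St1_def)

lemma St1E:
  assumes "f \<in> St1"
  obtains x y where "x \<in> \<Gamma>" "y \<in> \<Gamma>" "f = node False x y"
proof -
  obtain x y where f: "f = node False x y" "f \<in> \<Gamma>" using assms by (auto simp: St1_def)
  then have "x \<in> \<Gamma>" "y \<in> \<Gamma>" using node_in_Gamma by blast+
  with f(1) show thesis by (intro that)
qed

lemma normal_set_St1: "normal_set St1"
proof (rule normal_setI)
  fix f g assume "f \<in> St1" "g \<in> St1"
  then show "f \<circ> g \<in> St1" by (auto simp: St1_def)
next
  fix f assume f: "f \<in> St1"
  then obtain x y where xy: "x \<in> \<Gamma>" "y \<in> \<Gamma>" "f = node False x y" by (rule St1E)
  have "iv f = node False (iv x) (iv y)" using xy by simp
  moreover have "iv f \<in> \<Gamma>" using f by (simp add: St1_def)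
  ultimately show "iv f \<in> St1" unfolding St1_def by blast
next
  fix u f assume u: "u \<in> \<Gamma>" and f: "f \<in> St1"
  obtain e p q where pq: "p \<in> \<Gamma>" "q \<in> \<Gamma>" "u = node e p q" using u by (rule Gamma_cases)
  obtain x y where xy: "x \<in> \<Gamma>" "y \<in> \<Gamma>" "f = node False x y" using f by (rule St1E)
  have "u \<circ> f \<circ> iv u \<in> \<Gamma>" using u f by (simp add: St1_def)
  then show "u \<circ> f \<circ> iv u \<in> St1" unfolding pq(3) xy(3) using pq(1,2) by (simp add: node_St1 split: if_splits)
next
  show "id \<in> St1" using node_id[symmetric] unfolding St1_def by simp
qed (auto simp: St1_def)

lemma K0_St1: "K0 \<subseteq> St1"
proof (rule K0_least[OF normal_set_St1])
  show "gen_t \<in> St1" using gen_t_Gamma unfolding gen_t_node by (simp add: node_St1)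
qed

lemma reps_node: "r \<in> reps \<Longrightarrow> \<exists>x y. r = node False x y"
proof -
  assume "r \<in> reps"
  then obtain x y where "r = x \<circ> y" "x \<in> {id, gen_e}" "y \<in> {id, gen_b, gen_c, gen_d}"
    by (auto simp: reps_def)
  moreover have "\<exists>p q. x = node False p q" if "x \<in> {id, gen_e}" for x
    using that gen_e_node node_id by (metis emptyE insertE)
  moreover have "\<exists>p q. y = node False p q" if "y \<in> {id, gen_b, gen_c, gen_d}" for y
    using that gen_b_node gen_c_node gen_d_node node_id by (metis emptyE insertE)
  ultimately obtain p q p' q' where "r = node False p q \<circ> node False p' q'" by metis
  then show ?thesis by simp
qed

text \<open>In \<open>near_rep_cover\<close> the alternative with a leading \<open>a\<close> is
  impossible: \<open>a\<close> swaps the subtrees, whereas \<open>f\<close>, the elements of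
  \<open>reps\<close> and those of \<open>K0\<close> do not.\<close>

lemma St1_near:
  assumes "f \<in> St1"
  shows "near_rep f"
proof -
  obtain x y where f: "x \<in> \<Gamma>" "y \<in> \<Gamma>" "f = node False x y" using assms by (rule St1E)
  have fG: "f \<in> \<Gamma>" using assms by (simp add: St1_def)
  have "\<not> near_rep (gen_a \<circ> f)"
  proof
    assume "near_rep (gen_a \<circ> f)"
    then obtain r where r: "r \<in> reps" "congr (gen_a \<circ> f) r" by (auto simp: near_rep_def)
    then obtain p q where pq: "r = node False p q" using reps_node by blast
    have "p \<in> \<Gamma>" "q \<in> \<Gamma>" using reps_Gamma[OF r(1)] pq node_in_Gamma[of False p q] by simp_all
    then have "gen_a \<circ> f \<circ> iv r = node True (x \<circ> iv p) (y \<circ> iv q)"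
      by (simp add: f pq gen_a_node)
    then have "node True (x \<circ> iv p) (y \<circ> iv q) \<in> K0" using r(2) by (simp add: congr_def)
    then show False using K0_St1 by (auto simp: node_St1)
  qed
  with near_rep_cover[OF fG] show ?thesis by blast
qed

text \<open>Since \<open>reps\<close> centralizes \<open>d\<close>, this determines the image of the centralizer of \<open>d\<close> modulo \<open>K0\<close>.\<close>

lemma St1_centralizer_d:
  assumes "h \<in> St1"
  shows "\<exists>h'\<in>\<Gamma>. h' \<circ> gen_d \<circ> iv h' = gen_d \<and> iv h \<circ> h' \<in> K0"
proof -
  obtain r where r: "r \<in> reps" "congr h r" using St1_near[OF assms] by (auto simp: near_rep_def)
  have G: "r \<in> \<Gamma>" "h \<in> \<Gamma>" using congrD[OF r(2)] by auto
  have "r \<circ> gen_d \<circ> iv r = gen_d" using reps_d[OF r(1), symmetric] G by (simp add: comp_assoc)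
  moreover have "iv h \<circ> (r \<circ> iv h) \<circ> h \<in> K0"
    using congr_sym[OF r(2)] normal_set_conj'[OF normal_set_K0 G(2)] by (auto simp: congr_def)
  then have "iv h \<circ> r \<in> K0" using G by (simp add: comp_assoc)
  ultimately show ?thesis using G by blast
qed

text \<open>Level 0 is covered by \<open>reps\<close> and their products with \<open>a\<close>.
  Above it, a coset is determined by the swap bit and the cosets of both sections one level
  lower.\<close>

lemma cosets_KK_finite: "finite ((\<lambda>h. (\<lambda>k. k \<circ> h) ` KK m) ` \<Gamma>)"
proof (induction m)
  case 0
  have eq: "(\<lambda>k. k \<circ> h) ` K0 = (\<lambda>k. k \<circ> r) ` K0" if "congr h r" for h r
  proof -
    have sub: "(\<lambda>k. k \<circ> h) ` K0 \<subseteq> (\<lambda>k. k \<circ> r) ` K0" if c: "congr h r" for h r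
    proof
      fix f assume "f \<in> (\<lambda>k. k \<circ> h) ` K0"
      then obtain k where k: "k \<in> K0" "f = k \<circ> h" by blast
      have "k \<circ> (h \<circ> iv r) \<in> K0" using c k normal_setD(3)[OF normal_set_K0] by (auto simp: congr_def)
      moreover have "f = (k \<circ> (h \<circ> iv r)) \<circ> r" using c k by (simp add: congr_def comp_assoc)
      ultimately show "f \<in> (\<lambda>k. k \<circ> r) ` K0" by blast
    qed
    show ?thesis using sub[OF that] sub[OF congr_sym[OF that]] by blast
  qed
  have "(\<lambda>h. (\<lambda>k. k \<circ> h) ` K0) ` \<Gamma> \<subseteq> (\<lambda>h. (\<lambda>k. k \<circ> h) ` K0) ` (reps \<union> (\<lambda>r. gen_a \<circ> r) ` reps)"
  proof (rule image_subsetI)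
    fix h assume h: "h \<in> \<Gamma>"
    from near_rep_cover[OF h] obtain r where "r \<in> reps \<union> (\<lambda>r. gen_a \<circ> r) ` reps" "congr h r"
    proof
      assume "near_rep h" then show ?thesis using that by (auto simp: near_rep_def)
    next
      assume "near_rep (gen_a \<circ> h)"
      then obtain r where r: "r \<in> reps" "congr (gen_a \<circ> h) r" by (auto simp: near_rep_def)
      have "congr h (gen_a \<circ> r)" using congr_left[OF r(2) Gamma_gens(1)] by simp
      then show ?thesis using that r by blast
    qed
    then show "(\<lambda>k. k \<circ> h) ` K0 \<in> (\<lambda>h. (\<lambda>k. k \<circ> h) ` K0) ` (reps \<union> (\<lambda>r. gen_a \<circ> r) ` reps)"
      using eq by blast
  qed
  then show ?case using finite_reps by (simp add: finite_subset)
next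
  case (Suc m)
  let ?C = "\<lambda>m h. (\<lambda>k. k \<circ> h) ` KK m"
  let ?G = "\<lambda>(e, A, B). {node e p q | p q. p \<in> A \<and> q \<in> B}"
  have "?C (Suc m) ` \<Gamma> \<subseteq> ?G ` (UNIV \<times> ?C m ` \<Gamma> \<times> ?C m ` \<Gamma>)"
  proof (rule image_subsetI)
    fix h assume "h \<in> \<Gamma>"
    then obtain e x y where xy: "x \<in> \<Gamma>" "y \<in> \<Gamma>" "h = node e x y" by (rule Gamma_cases)
    have "?C (Suc m) h = {node e p q | p q. p \<in> ?C m x \<and> q \<in> ?C m y}"
    proof (intro Set.set_eqI iffI)
      fix f assume "f \<in> ?C (Suc m) h"
      then obtain k where k: "k \<in> KK (Suc m)" "f = k \<circ> h" by blast
      from k(1) obtain p q where pq: "p \<in> KK m" "q \<in> KK m" "k = node False p q" by (rule KKSE)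
      have "f = node e ((if e then q else p) \<circ> x) ((if e then p else q) \<circ> y)"
        unfolding k(2) pq(3) xy by simp
      then show "f \<in> {node e p q | p q. p \<in> ?C m x \<and> q \<in> ?C m y}"
        using pq(1,2) by (cases e) auto
    next
      fix f assume "f \<in> {node e p q | p q. p \<in> ?C m x \<and> q \<in> ?C m y}"
      then obtain p q where pq: "p \<in> KK m" "q \<in> KK m" "f = node e (p \<circ> x) (q \<circ> y)" by blast
      then have "f = (if e then node False q p else node False p q) \<circ> h" unfolding xy by simp
      moreover have "(if e then node False q p else node False p q) \<in> KK (Suc m)" using pq by simp
      ultimately show "f \<in> ?C (Suc m) h" by (rule image_eqI)
    qed
    then have "?C (Suc m) h = ?G (e, ?C m x, ?C m y)" by (simp only: prod.case)
    moreover have "(e, ?C m x, ?C m y) \<in> UNIV \<times> ?C m ` \<Gamma> \<times> ?C m ` \<Gamma>" using xy by blast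
    ultimately show "?C (Suc m) h \<in> ?G ` (UNIV \<times> ?C m ` \<Gamma> \<times> ?C m ` \<Gamma>)" by (rule image_eqI)
  qed
  moreover have "finite (UNIV \<times> ?C m ` \<Gamma> \<times> ?C m ` \<Gamma> :: (bool \<times> _ \<times> _) set)"
    using Suc.IH by (intro finite_cartesian_product) simp_all
  ultimately show ?case by (meson finite_imageI finite_subset)
qed

lemma square_St1:
  assumes "f \<in> \<Gamma>"
  shows "f \<circ> f \<in> St1"
proof -
  obtain e x y where "x \<in> \<Gamma>" "y \<in> \<Gamma>" "f = node e x y" using assms by (rule Gamma_cases)
  then show ?thesis using assms Gamma_comp[OF assms assms] by (auto simp: St1_def)
qed

text \<open>Modulo \<open>K0\<close> the involution \<open>gen_e\<close> commutes with
  \<open>b\<close> and \<open>d\<close>, hence with \<open>c = bd\<close>; so every product in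
  \<open>reps\<close> squares to the identity there.\<close>

lemma congr_reps_square:
  assumes "r \<in> reps"
  shows "congr (r \<circ> r) id"
proof -
  obtain x y where r: "r = x \<circ> y" "x \<in> {id, gen_e}" "y \<in> {id, gen_b, gen_c, gen_d}"
    using assms by (auto simp: reps_def)
  have e: "gen_e \<circ> (gen_d \<circ> f) = gen_d \<circ> (gen_e \<circ> f)" for f
    using gen_e_d by (metis comp_assoc)
  have "congr ((gen_b \<circ> gen_e) \<circ> (gen_b \<circ> gen_e)) ((gen_e \<circ> gen_b) \<circ> (gen_b \<circ> gen_e))"
    by (rule congr_right[OF congr_be]) simp
  then have 1: "congr (gen_b \<circ> (gen_e \<circ> (gen_b \<circ> gen_e))) id" by (simp add: comp_assoc)
  have "congr (gen_e \<circ> (gen_b \<circ> (gen_e \<circ> (gen_b \<circ> gen_e))) \<circ> gen_e) (gen_e \<circ> id \<circ> gen_e)"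
    by (intro congr_right congr_left 1) simp_all
  then have 2: "congr (gen_e \<circ> (gen_b \<circ> (gen_e \<circ> gen_b))) id" by (simp add: comp_assoc)
  have "gen_e \<circ> (gen_c \<circ> (gen_e \<circ> gen_c)) = gen_e \<circ> (gen_b \<circ> (gen_d \<circ> (gen_e \<circ> (gen_d \<circ> gen_b))))"
    by simp
  also have "\<dots> = gen_e \<circ> (gen_b \<circ> (gen_e \<circ> gen_b))"
    by (simp only: e gen_squares)
  finally have 3: "congr (gen_e \<circ> (gen_c \<circ> (gen_e \<circ> gen_c))) id" using 2 by simp
  have 4: "gen_e \<circ> (gen_d \<circ> (gen_e \<circ> gen_d)) = id" by (simp add: e)
  show ?thesis
    using r(2,3) congr_refl[of id] 2 3 4 unfolding r(1) by (auto simp: comp_assoc)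
qed

lemma St1_square:
  assumes "h \<in> St1"
  shows "h \<circ> h \<in> K0"
proof -
  obtain r where r: "r \<in> reps" "congr h r" using St1_near[OF assms] by (auto simp: near_rep_def)
  have "congr (h \<circ> h) (h \<circ> r)" using congr_left[OF r(2)] congrD[OF r(2)] by blast
  also have "congr (h \<circ> r) (r \<circ> r)" using congr_right[OF r(2)] congrD[OF r(2)] by blast
  also have "congr (r \<circ> r) id" by (rule congr_reps_square[OF r(1)])
  finally show ?thesis by (simp add: congr_def)
qed

lemma node_funpow: "node False x y ^^ n = node False (x ^^ n) (y ^^ n)"
  by (induction n) simp_all

text \<open>Squares stabilize the first level and squares of stabilizing elements lie in
  \<open>K0\<close>, so fourth powers suffice for level 0. Each further level costs one squaring,
  after which the hypothesis applies to both sections.\<close>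

lemma KK_exponent: "\<exists>k. \<forall>f\<in>\<Gamma>. f ^^ 2 ^ k \<in> KK m"
proof (induction m)
  case 0
  have "f ^^ 2 ^ 2 \<in> KK 0" if "f \<in> \<Gamma>" for f
    using St1_square[OF square_St1[OF that]] by (simp add: numeral_eq_Suc comp_assoc)
  then show ?case by blast
next
  case (Suc m)
  then obtain k where k: "\<And>f. f \<in> \<Gamma> \<Longrightarrow> f ^^ 2 ^ k \<in> KK m" by blast
  have "f ^^ 2 ^ Suc k \<in> KK (Suc m)" if f: "f \<in> \<Gamma>" for f
  proof -
    obtain x y where xy: "x \<in> \<Gamma>" "y \<in> \<Gamma>" "f \<circ> f = node False x y"
      using square_St1[OF f] by (rule St1E)
    have "f ^^ 2 ^ Suc k = (f ^^ 2) ^^ 2 ^ k" by (simp only: funpow_mult power_Suc)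
    also have "f ^^ 2 = node False x y" using xy(3) by (simp add: numeral_eq_Suc)
    finally show ?thesis using k xy by (simp add: node_funpow)
  qed
  then show ?case by blast
qed

section \<open>Approximate conjugators\<close>

text \<open>\<open>conj_lift S f g m\<close>: an element of \<open>S\<close> conjugating \<open>f\<close> to \<open>g\<close> modulo a deep enough \<open>KK n\<close> agrees modulo
  \<open>KK m\<close> with an actual conjugator. \<open>conj_sep S f g\<close> is the vacuous case.\<close>

definition conj_lift :: "(word \<Rightarrow> word) set \<Rightarrow> (word \<Rightarrow> word) \<Rightarrow> (word \<Rightarrow> word) \<Rightarrow> nat \<Rightarrow> bool" where
  "conj_lift S f g m \<longleftrightarrow> (\<exists>n. \<forall>h\<in>S. h \<circ> f \<circ> iv h \<circ> iv g \<in> KK n \<longrightarrow>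
     (\<exists>h'\<in>\<Gamma>. h' \<circ> f \<circ> iv h' = g \<and> iv h \<circ> h' \<in> KK m))"

definition conj_sep :: "(word \<Rightarrow> word) set \<Rightarrow> (word \<Rightarrow> word) \<Rightarrow> (word \<Rightarrow> word) \<Rightarrow> bool" where
  "conj_sep S f g \<longleftrightarrow> (\<exists>n. \<forall>h\<in>S. h \<circ> f \<circ> iv h \<circ> iv g \<notin> KK n)"

lemma conj_sep_apx: "conj_sep S f g \<Longrightarrow> conj_lift S f g m"
  unfolding conj_sep_def conj_lift_def by blast

text \<open>The \<open>KK n\<close> decrease, so the level may be raised at will; this permits one
  common level for two hypotheses.\<close>

lemma conj_lift_level:
  assumes "conj_lift S f g m"
  obtains n where "n \<ge> N"
    "\<And>h. h \<in> S \<Longrightarrow> h \<circ> f \<circ> iv h \<circ> iv g \<in> KK n \<Longrightarrow> \<exists>h'\<in>\<Gamma>. h' \<circ> f \<circ> iv h' = g \<and> iv h \<circ> h' \<in> KK m"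
proof -
  obtain n where n: "\<And>h. h \<in> S \<Longrightarrow> h \<circ> f \<circ> iv h \<circ> iv g \<in> KK n \<Longrightarrow> \<exists>h'\<in>\<Gamma>. h' \<circ> f \<circ> iv h' = g \<and> iv h \<circ> h' \<in> KK m"
    using assms unfolding conj_lift_def by blast
  show thesis
    by (rule that[of "max n N"]) (use n KK_mono[of n "max n N"] in auto)
qed

lemma conj_sep_level:
  assumes "conj_sep S f g"
  obtains n where "n \<ge> N" "\<And>h. h \<in> S \<Longrightarrow> h \<circ> f \<circ> iv h \<circ> iv g \<notin> KK n"
proof -
  obtain n where n: "\<And>h. h \<in> S \<Longrightarrow> h \<circ> f \<circ> iv h \<circ> iv g \<notin> KK n"
    using assms unfolding conj_sep_def by blast
  show thesis
    by (rule that[of "max n N"]) (use n KK_mono[of n "max n N"] in auto)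
qed

lemma conj_lift_antimono: "conj_lift S f g m \<Longrightarrow> k \<le> m \<Longrightarrow> conj_lift S f g k"
  unfolding conj_lift_def using KK_mono[of k m] by (meson subsetD)

section \<open>Reduction of approximate conjugacy to sections\<close>

lemma conj_lift_conj:
  assumes conj_lift: "conj_lift \<Gamma> f g m" and G: "f \<in> \<Gamma>" "g \<in> \<Gamma>" "u \<in> \<Gamma>" "w \<in> \<Gamma>"
  shows "conj_lift \<Gamma> (u \<circ> f \<circ> iv u) (w \<circ> g \<circ> iv w) m"
proof -
  obtain n where n: "\<And>h. h \<in> \<Gamma> \<Longrightarrow> h \<circ> f \<circ> iv h \<circ> iv g \<in> KK n \<Longrightarrow> \<exists>h'\<in>\<Gamma>. h' \<circ> f \<circ> iv h' = g \<and> iv h \<circ> h' \<in> KK m"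
    using conj_lift unfolding conj_lift_def by blast
  have "\<exists>h'\<in>\<Gamma>. h' \<circ> (u \<circ> f \<circ> iv u) \<circ> iv h' = w \<circ> g \<circ> iv w \<and> iv h \<circ> h' \<in> KK m"
    if h: "h \<in> \<Gamma>" and k: "h \<circ> (u \<circ> f \<circ> iv u) \<circ> iv h \<circ> iv (w \<circ> g \<circ> iv w) \<in> KK n" for h
  proof -
    \<comment> \<open>If \<open>h\<close> conjugates \<open>u f u^-1\<close> to
      \<open>w g w^-1\<close> modulo \<open>KK n\<close>, then this element conjugates
      \<open>f\<close> to \<open>g\<close> modulo \<open>KK n\<close>.\<close>
    let ?h = "iv w \<circ> h \<circ> u"
    have "?h \<circ> f \<circ> iv ?h \<circ> iv g \<in> KK n"
      using normal_set_conj'[OF normal_set_KK G(4) k] h G by (simp add: comp_assoc)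
    then obtain h' where h': "h' \<in> \<Gamma>" "h' \<circ> f \<circ> iv h' = g" "iv ?h \<circ> h' \<in> KK m"
      using n[of ?h] h G by auto
    have "w \<circ> h' \<circ> iv u \<in> \<Gamma>" using h' G by simp
    moreover have "(w \<circ> h' \<circ> iv u) \<circ> (u \<circ> f \<circ> iv u) \<circ> iv (w \<circ> h' \<circ> iv u) = w \<circ> g \<circ> iv w"
      using h' G by (simp add: comp_assoc flip: h'(2))
    moreover have "iv h \<circ> (w \<circ> h' \<circ> iv u) \<in> KK m"
      using normal_setD(5)[OF normal_set_KK G(3) h'(3)] h G by (simp add: comp_assoc)
    ultimately show ?thesis by blast
  qed
  then show ?thesis unfolding conj_lift_def by blast
qed

lemma coset_St1:
  assumes "h \<in> \<Gamma>"
  shows "h \<in> St1 \<or> h \<circ> gen_a \<in> St1"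
proof -
  obtain e x y where h: "x \<in> \<Gamma>" "y \<in> \<Gamma>" "h = node e x y" using assms by (rule Gamma_cases)
  have "h \<circ> gen_a \<in> \<Gamma>" using assms by simp
  then show ?thesis using assms unfolding h(3) by (cases e) (simp_all add: node_St1 gen_a_node)
qed

text \<open>\<open>St1\<close> has the two cosets \<open>St1\<close> and \<open>St1 a\<close>; a
  conjugator \<open>h\<close> from the second one becomes a conjugator \<open>h a\<close> of
  \<open>a f a\<close> to \<open>g\<close> in \<open>St1\<close>.\<close>

lemma conj_lift_swap:
  assumes 1: "conj_lift St1 f g m" and 2: "conj_lift St1 (gen_a \<circ> f \<circ> gen_a) g m"
  shows "conj_lift \<Gamma> f g m"
proof -
  obtain n1 where n1: "\<And>h. h \<in> St1 \<Longrightarrow> h \<circ> f \<circ> iv h \<circ> iv g \<in> KK n1 \<Longrightarrow>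
      \<exists>h'\<in>\<Gamma>. h' \<circ> f \<circ> iv h' = g \<and> iv h \<circ> h' \<in> KK m"
    using 1 unfolding conj_lift_def by blast
  obtain n where n: "n \<ge> n1" "\<And>h. h \<in> St1 \<Longrightarrow> h \<circ> (gen_a \<circ> f \<circ> gen_a) \<circ> iv h \<circ> iv g \<in> KK n \<Longrightarrow>
      \<exists>h'\<in>\<Gamma>. h' \<circ> (gen_a \<circ> f \<circ> gen_a) \<circ> iv h' = g \<and> iv h \<circ> h' \<in> KK m"
    using conj_lift_level[OF 2, of n1] by blast
  have "\<exists>h'\<in>\<Gamma>. h' \<circ> f \<circ> iv h' = g \<and> iv h \<circ> h' \<in> KK m"
    if h: "h \<in> \<Gamma>" and k: "h \<circ> f \<circ> iv h \<circ> iv g \<in> KK n" for h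
    using coset_St1[OF h]
  proof
    assume "h \<in> St1"
    then show ?thesis using n1 k KK_mono[OF n(1)] by blast
  next
    let ?h = "h \<circ> gen_a"
    assume s: "?h \<in> St1"
    have "?h \<circ> (gen_a \<circ> f \<circ> gen_a) \<circ> iv ?h \<circ> iv g \<in> KK n" using k h by (simp add: comp_assoc)
    then obtain h' where h': "h' \<in> \<Gamma>" "h' \<circ> (gen_a \<circ> f \<circ> gen_a) \<circ> iv h' = g" "iv ?h \<circ> h' \<in> KK m"
      using n(2)[OF s] by blast
    have "h' \<circ> gen_a \<in> \<Gamma>" using h' by simp
    moreover have "(h' \<circ> gen_a) \<circ> f \<circ> iv (h' \<circ> gen_a) = g"
      using h'(1) by (simp add: comp_assoc flip: h'(2))
    moreover have "iv h \<circ> (h' \<circ> gen_a) \<in> KK m"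
      using normal_setD(5)[OF normal_set_KK Gamma_gens(1) h'(3)] h by (simp add: comp_assoc)
    ultimately show ?thesis by blast
  qed
  then show ?thesis unfolding conj_lift_def by blast
qed

lemma conj_sep_swap:
  assumes 1: "conj_sep St1 f g" and 2: "conj_sep St1 (gen_a \<circ> f \<circ> gen_a) g"
  shows "conj_sep \<Gamma> f g"
proof -
  obtain n1 where n1: "\<And>h. h \<in> St1 \<Longrightarrow> h \<circ> f \<circ> iv h \<circ> iv g \<notin> KK n1"
    using 1 unfolding conj_sep_def by blast
  obtain n where n: "n \<ge> n1" "\<And>h. h \<in> St1 \<Longrightarrow> h \<circ> (gen_a \<circ> f \<circ> gen_a) \<circ> iv h \<circ> iv g \<notin> KK n"
    using conj_sep_level[OF 2, of n1] by blast
  have "h \<circ> f \<circ> iv h \<circ> iv g \<notin> KK n" if h: "h \<in> \<Gamma>" for h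
    using coset_St1[OF h]
  proof
    assume "h \<in> St1"
    then show ?thesis using n1 KK_mono[OF n(1)] by blast
  next
    assume "h \<circ> gen_a \<in> St1"
    from n(2)[OF this] show ?thesis using h by (simp add: comp_assoc)
  qed
  then show ?thesis unfolding conj_sep_def by blast
qed

text \<open>An element of \<open>St1\<close> acts on the two sections separately, so its sections
  can be corrected independently.\<close>

lemma conj_lift_sections:
  assumes G: "node False f0 f1 \<in> \<Gamma>" "node False g0 g1 \<in> \<Gamma>"
    and conj_lift: "conj_lift \<Gamma> f0 g0 m" "conj_lift \<Gamma> f1 g1 m"
  shows "conj_lift St1 (node False f0 f1) (node False g0 g1) (Suc m)"
proof -
  obtain n0 where n0: "\<And>h. h \<in> \<Gamma> \<Longrightarrow> h \<circ> f0 \<circ> iv h \<circ> iv g0 \<in> KK n0 \<Longrightarrow>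
      \<exists>h'\<in>\<Gamma>. h' \<circ> f0 \<circ> iv h' = g0 \<and> iv h \<circ> h' \<in> KK m"
    using conj_lift(1) unfolding conj_lift_def by blast
  obtain n where n: "n \<ge> n0" "\<And>h. h \<in> \<Gamma> \<Longrightarrow> h \<circ> f1 \<circ> iv h \<circ> iv g1 \<in> KK n \<Longrightarrow>
      \<exists>h'\<in>\<Gamma>. h' \<circ> f1 \<circ> iv h' = g1 \<and> iv h \<circ> h' \<in> KK m"
    using conj_lift_level[OF conj_lift(2), of n0] by blast
  have G': "f0 \<in> \<Gamma>" "f1 \<in> \<Gamma>" "g0 \<in> \<Gamma>" "g1 \<in> \<Gamma>" using G node_in_Gamma by blast+
  have "\<exists>h'\<in>\<Gamma>. h' \<circ> node False f0 f1 \<circ> iv h' = node False g0 g1 \<and> iv h \<circ> h' \<in> KK (Suc m)"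
    if h: "h \<in> St1" and k: "h \<circ> node False f0 f1 \<circ> iv h \<circ> iv (node False g0 g1) \<in> KK (Suc n)" for h
  proof -
    obtain h0 h1 where hh: "h0 \<in> \<Gamma>" "h1 \<in> \<Gamma>" "h = node False h0 h1" using h by (rule St1E)
    have k': "h0 \<circ> f0 \<circ> iv h0 \<circ> iv g0 \<in> KK n" "h1 \<circ> f1 \<circ> iv h1 \<circ> iv g1 \<in> KK n"
      using k hh(1,2) G' unfolding hh(3) by simp_all
    obtain p where p: "p \<in> \<Gamma>" "p \<circ> f0 \<circ> iv p = g0" "iv h0 \<circ> p \<in> KK m"
      using n0[OF hh(1)] k'(1) KK_mono[OF n(1)] by blast
    obtain q where q: "q \<in> \<Gamma>" "q \<circ> f1 \<circ> iv q = g1" "iv h1 \<circ> q \<in> KK m"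
      using n(2)[OF hh(2) k'(2)] by blast
    have 1: "iv h \<circ> node False p q \<in> KK (Suc m)" using p q hh(1,2) unfolding hh(3) by simp
    have "h \<in> \<Gamma>" using h by (simp add: St1_def)
    \<comment> \<open>A pair of elements of \<open>\<Gamma>\<close> need not define an element of
      \<open>\<Gamma>\<close>. This one does, as it differs from \<open>h\<close> by an element of
      \<open>KK (Suc m)\<close>, which branching places inside \<open>\<Gamma>\<close>.\<close>
    then have "h \<circ> (iv h \<circ> node False p q) \<in> \<Gamma>" using KK_Gamma[OF 1] by (rule Gamma_comp)
    then have "node False p q \<in> \<Gamma>" using \<open>h \<in> \<Gamma>\<close> by simp
    moreover have "node False p q \<circ> node False f0 f1 \<circ> iv (node False p q) = node False g0 g1"
      using p q by simp
    ultimately show ?thesis using 1 by blast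
  qed
  then show ?thesis unfolding conj_lift_def by blast
qed

lemma conj_sep_sections:
  assumes G: "node False f0 f1 \<in> \<Gamma>" "node False g0 g1 \<in> \<Gamma>"
    and conj_sep: "conj_sep \<Gamma> f0 g0 \<or> conj_sep \<Gamma> f1 g1"
  shows "conj_sep St1 (node False f0 f1) (node False g0 g1)"
proof -
  have G': "f0 \<in> \<Gamma>" "f1 \<in> \<Gamma>" "g0 \<in> \<Gamma>" "g1 \<in> \<Gamma>" using G node_in_Gamma by blast+
  obtain n where n: "\<And>h0 h1. h0 \<in> \<Gamma> \<Longrightarrow> h1 \<in> \<Gamma> \<Longrightarrow> h0 \<circ> f0 \<circ> iv h0 \<circ> iv g0 \<notin> KK n \<or> h1 \<circ> f1 \<circ> iv h1 \<circ> iv g1 \<notin> KK n"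
    using conj_sep unfolding conj_sep_def by blast
  have "h \<circ> node False f0 f1 \<circ> iv h \<circ> iv (node False g0 g1) \<notin> KK (Suc n)" if h: "h \<in> St1" for h
  proof -
    obtain h0 h1 where hh: "h0 \<in> \<Gamma>" "h1 \<in> \<Gamma>" "h = node False h0 h1" using h by (rule St1E)
    then show ?thesis using n[OF hh(1,2)] G' by simp
  qed
  then show ?thesis unfolding conj_sep_def by blast
qed

text \<open>If \<open>h = (h0, h1)\<close> conjugates \<open>(f0, f1)a\<close> to \<open>(g0, g1)a\<close>, then \<open>h0\<close> conjugates \<open>f1 f0\<close> to \<open>g1 g0\<close>
  and it determines \<open>h1 = g0 h0 f0^-1\<close>.\<close>

lemma conj_lift_odd_St1:
  assumes G: "node True f0 f1 \<in> \<Gamma>" "node True g0 g1 \<in> \<Gamma>"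
    and conj_lift: "conj_lift \<Gamma> (f1 \<circ> f0) (g1 \<circ> g0) m"
  shows "conj_lift St1 (node True f0 f1) (node True g0 g1) (Suc m)"
proof -
  have G': "f0 \<in> \<Gamma>" "f1 \<in> \<Gamma>" "g0 \<in> \<Gamma>" "g1 \<in> \<Gamma>" using G node_in_Gamma by blast+
  obtain n where n: "n \<ge> m" "\<And>h. h \<in> \<Gamma> \<Longrightarrow> h \<circ> (f1 \<circ> f0) \<circ> iv h \<circ> iv (g1 \<circ> g0) \<in> KK n \<Longrightarrow>
      \<exists>h'\<in>\<Gamma>. h' \<circ> (f1 \<circ> f0) \<circ> iv h' = g1 \<circ> g0 \<and> iv h \<circ> h' \<in> KK m"
    using conj_lift_level[OF conj_lift, of m] by blast
  have "\<exists>h'\<in>\<Gamma>. h' \<circ> node True f0 f1 \<circ> iv h' = node True g0 g1 \<and> iv h \<circ> h' \<in> KK (Suc m)"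
    if h: "h \<in> St1" and k: "h \<circ> node True f0 f1 \<circ> iv h \<circ> iv (node True g0 g1) \<in> KK (Suc n)" for h
  proof -
    obtain h0 h1 where hh: "h0 \<in> \<Gamma>" "h1 \<in> \<Gamma>" "h = node False h0 h1" using h by (rule St1E)
    have A: "h1 \<circ> f0 \<circ> iv h0 \<circ> iv g0 \<in> KK n" (is "?A \<in> _") and B: "h0 \<circ> f1 \<circ> iv h1 \<circ> iv g1 \<in> KK n" (is "?B \<in> _")
      using k hh(1,2) G' unfolding hh(3) by simp_all
    \<comment> \<open>Combining both approximate equations eliminates \<open>h1\<close> and leaves
      one for \<open>h0\<close> with the products of the sections.\<close>
    have "?B \<circ> (g1 \<circ> ?A \<circ> iv g1) \<in> KK n"
      using normal_setD(3)[OF normal_set_KK B normal_setD(5)[OF normal_set_KK G'(4) A]] .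
    moreover have "?B \<circ> (g1 \<circ> ?A \<circ> iv g1) = h0 \<circ> (f1 \<circ> f0) \<circ> iv h0 \<circ> iv (g1 \<circ> g0)"
      using hh(1,2) G' by (simp add: comp_assoc)
    ultimately obtain p where p: "p \<in> \<Gamma>" "p \<circ> (f1 \<circ> f0) \<circ> iv p = g1 \<circ> g0" "iv h0 \<circ> p \<in> KK m"
      using n(2)[OF hh(1)] by auto
    let ?q = "g0 \<circ> p \<circ> iv f0"
    have q: "?q \<in> \<Gamma>" using G' p by simp
    \<comment> \<open>Here \<open>n \<ge> m\<close> is used: the second section is corrected by a
      conjugate of \<open>iv ?A\<close>, which must be trivial modulo \<open>KK m\<close>.\<close>
    have Am: "iv ?A \<in> KK m" using normal_setD(4)[OF normal_set_KK A] KK_mono[OF n(1)] by blast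
    have "(iv h0 \<circ> (iv g0 \<circ> iv ?A \<circ> g0) \<circ> h0) \<circ> (iv h0 \<circ> p) \<in> KK m"
      by (intro normal_setD(3)[OF normal_set_KK _ p(3)] normal_set_conj'[OF normal_set_KK] Am G' hh)
    then have "f0 \<circ> ((iv h0 \<circ> (iv g0 \<circ> iv ?A \<circ> g0) \<circ> h0) \<circ> (iv h0 \<circ> p)) \<circ> iv f0 \<in> KK m"
      by (rule normal_setD(5)[OF normal_set_KK G'(1)])
    also have "f0 \<circ> ((iv h0 \<circ> (iv g0 \<circ> iv ?A \<circ> g0) \<circ> h0) \<circ> (iv h0 \<circ> p)) \<circ> iv f0 = iv h1 \<circ> ?q"
      using hh(1,2) G' p(1) by (simp add: comp_assoc)
    finally have 1: "iv h \<circ> node False p ?q \<in> KK (Suc m)" using p hh(1,2) unfolding hh(3) by simp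
    have "h \<in> \<Gamma>" using h by (simp add: St1_def)
    then have "h \<circ> (iv h \<circ> node False p ?q) \<in> \<Gamma>" using KK_Gamma[OF 1] by (rule Gamma_comp)
    then have "node False p ?q \<in> \<Gamma>" using \<open>h \<in> \<Gamma>\<close> by simp
    moreover have "node False p ?q \<circ> node True f0 f1 \<circ> iv (node False p ?q) = node True g0 g1"
    proof -
      have "p \<circ> f1 \<circ> iv ?q = (p \<circ> (f1 \<circ> f0) \<circ> iv p) \<circ> iv g0"
        using p(1) G' by (simp add: comp_assoc)
      also have "\<dots> = g1" unfolding p(2) using G' by (simp add: comp_assoc)
      finally have "p \<circ> f1 \<circ> iv ?q = g1" .
      moreover have "?q \<circ> f0 \<circ> iv p = g0" using p(1) G' by (simp add: comp_assoc)
      ultimately show ?thesis using p(1) q G' by simp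
    qed
    ultimately show ?thesis using 1 by blast
  qed
  then show ?thesis unfolding conj_lift_def by blast
qed

text \<open>Swapping the subtrees or not is a homomorphism onto a group of order two, which kills
  every \<open>KK n\<close>.\<close>

lemma conj_sep_parity:
  assumes "node e f0 f1 \<in> \<Gamma>" "node e' g0 g1 \<in> \<Gamma>" "e \<noteq> e'"
  shows "conj_sep \<Gamma> (node e f0 f1) (node e' g0 g1)"
proof -
  have G': "f0 \<in> \<Gamma>" "f1 \<in> \<Gamma>" "g0 \<in> \<Gamma>" "g1 \<in> \<Gamma>" using assms node_in_Gamma by blast+
  have "h \<circ> node e f0 f1 \<circ> iv h \<circ> iv (node e' g0 g1) \<notin> KK (Suc 0)" if h: "h \<in> \<Gamma>" for h
  proof -
    obtain j h0 h1 where hh: "h0 \<in> \<Gamma>" "h1 \<in> \<Gamma>" "h = node j h0 h1" using h by (rule Gamma_cases)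
    show ?thesis using assms(3) hh(1,2) G' unfolding hh(3)
      by (cases e; cases e'; cases j) (simp_all del: KK.simps)
  qed
  then show ?thesis unfolding conj_sep_def by blast
qed

text \<open>The last hypothesis handles conjugators that swap the subtrees: either the crossed pairs
  of sections lift as well, or one crossed pair is separated and no such conjugator exists at a deep
  level.\<close>

lemma conj_lift_even:
  assumes "node False f0 f1 \<in> \<Gamma>" "node False g0 g1 \<in> \<Gamma>"
    and "conj_lift \<Gamma> f0 g0 m" "conj_lift \<Gamma> f1 g1 m"
    and "conj_lift \<Gamma> f1 g0 m \<and> conj_lift \<Gamma> f0 g1 m \<or> conj_sep \<Gamma> f1 g0"
  shows "conj_lift \<Gamma> (node False f0 f1) (node False g0 g1) (Suc m)"
proof (rule conj_lift_swap)
  have sw: "node False f1 f0 \<in> \<Gamma>"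
    using Gamma_comp[OF Gamma_comp[OF Gamma_gens(1) assms(1)] Gamma_gens(1)] by (simp only: node_swap)
  show "conj_lift St1 (gen_a \<circ> node False f0 f1 \<circ> gen_a) (node False g0 g1) (Suc m)"
    unfolding node_swap using assms(5)
  proof
    assume "conj_sep \<Gamma> f1 g0"
    then show "conj_lift St1 (node False f1 f0) (node False g0 g1) (Suc m)"
      by (intro conj_sep_apx conj_sep_sections sw assms) blast
  qed (intro conj_lift_sections sw assms, auto)
qed (use assms conj_lift_sections in auto)

lemma conj_sep_even:
  assumes "node False f0 f1 \<in> \<Gamma>" "node False g0 g1 \<in> \<Gamma>"
    and "conj_sep \<Gamma> f0 g0 \<or> conj_sep \<Gamma> f1 g1" "conj_sep \<Gamma> f1 g0 \<or> conj_sep \<Gamma> f0 g1"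
  shows "conj_sep \<Gamma> (node False f0 f1) (node False g0 g1)"
proof (rule conj_sep_swap)
  have sw: "node False f1 f0 \<in> \<Gamma>"
    using Gamma_comp[OF Gamma_comp[OF Gamma_gens(1) assms(1)] Gamma_gens(1)] by (simp only: node_swap)
  show "conj_sep St1 (gen_a \<circ> node False f0 f1 \<circ> gen_a) (node False g0 g1)"
    unfolding node_swap by (intro conj_sep_sections sw assms)
qed (use assms conj_sep_sections in auto)

text \<open>Swapping the subtrees replaces \<open>f1 f0\<close> by \<open>f0 f1\<close>, which is
  its conjugate by \<open>f0\<close>.\<close>

lemma conj_lift_odd:
  assumes G: "node True f0 f1 \<in> \<Gamma>" "node True g0 g1 \<in> \<Gamma>"
    and conj_lift: "conj_lift \<Gamma> (f1 \<circ> f0) (g1 \<circ> g0) m"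
  shows "conj_lift \<Gamma> (node True f0 f1) (node True g0 g1) (Suc m)"
proof (rule conj_lift_swap[OF conj_lift_odd_St1[OF assms]])
  have sw: "node True f1 f0 \<in> \<Gamma>"
    using Gamma_comp[OF Gamma_comp[OF Gamma_gens(1) G(1)] Gamma_gens(1)] by (simp only: node_swap)
  have G': "f0 \<in> \<Gamma>" "f1 \<in> \<Gamma>" "g0 \<in> \<Gamma>" "g1 \<in> \<Gamma>" using G node_in_Gamma by blast+
  have "conj_lift \<Gamma> (f0 \<circ> (f1 \<circ> f0) \<circ> iv f0) (id \<circ> (g1 \<circ> g0) \<circ> iv id) m"
    using conj_lift_conj[OF conj_lift _ _ G'(1) Gamma_id] G' by simp
  then have "conj_lift \<Gamma> (f0 \<circ> f1) (g1 \<circ> g0) m" using G' by (simp add: comp_assoc)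
  then show "conj_lift St1 (gen_a \<circ> node True f0 f1 \<circ> gen_a) (node True g0 g1) (Suc m)"
    unfolding node_swap by (intro conj_lift_odd_St1 sw G)
qed

lemma conj_lift_SucD: "conj_lift S f g (Suc m) \<Longrightarrow> conj_lift S f g m"
  by (erule conj_lift_antimono) simp

section \<open>The generators\<close>

lemma gens_node_Gamma:
  "node True id id \<in> \<Gamma>" "node False gen_a gen_c \<in> \<Gamma>" "node False gen_a gen_d \<in> \<Gamma>" "node False id gen_b \<in> \<Gamma>"
  "node False id id \<in> \<Gamma>"
  using Gamma_gens Gamma_id by (simp_all flip: gen_a_node gen_b_node gen_c_node gen_d_node)

lemma conj_sep_a:
  assumes "s \<in> {id, gen_b, gen_c, gen_d}"
  shows "conj_sep \<Gamma> gen_a s" "conj_sep \<Gamma> s gen_a"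
proof -
  obtain x y where s: "s = node False x y"
    using assms gen_b_node gen_c_node gen_d_node node_id[symmetric] by blast
  have "node False x y \<in> \<Gamma>" using s assms by auto
  then show "conj_sep \<Gamma> gen_a s" "conj_sep \<Gamma> s gen_a"
    unfolding gen_a_node s by (auto intro!: conj_sep_parity gens_node_Gamma)
qed

text \<open>\<open>b\<close> and \<open>c\<close> have the section \<open>a\<close>, which parity
  separates from \<open>id\<close>; \<open>d\<close> then has the section \<open>b\<close>.\<close>

lemma conj_sep_1: 
  assumes "s \<in> {gen_b, gen_c, gen_d}"
  shows "conj_sep \<Gamma> id s" "conj_sep \<Gamma> s id"
proof -
  have b: "conj_sep \<Gamma> id gen_b" "conj_sep \<Gamma> gen_b id"
    by (subst (1) node_id[symmetric], subst gen_b_node, rule conj_sep_even; (intro gens_node_Gamma)?; simp add: conj_sep_a)+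
  have c: "conj_sep \<Gamma> id gen_c" "conj_sep \<Gamma> gen_c id"
    by (subst (1) node_id[symmetric], subst gen_c_node, rule conj_sep_even; (intro gens_node_Gamma)?; simp add: conj_sep_a)+
  have d: "conj_sep \<Gamma> id gen_d" "conj_sep \<Gamma> gen_d id"
    by (subst (1) node_id[symmetric], subst gen_d_node, rule conj_sep_even; (intro gens_node_Gamma)?; simp add: b)+
  show "conj_sep \<Gamma> id s" "conj_sep \<Gamma> s id" using b c d assms by auto
qed

text \<open>\<open>d\<close> has the section \<open>id\<close> where \<open>b\<close> and
  \<open>c\<close> have \<open>a\<close>, so parity separates it from both. For \<open>b\<close>
  against \<open>c\<close> the straight pairing contains \<open>c\<close> against \<open>d\<close>,
  and the crossed one is separated by parity.\<close>

lemma conj_sep_bcd: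
  "conj_sep \<Gamma> gen_b gen_d" "conj_sep \<Gamma> gen_d gen_b" "conj_sep \<Gamma> gen_c gen_d" "conj_sep \<Gamma> gen_d gen_c"
  "conj_sep \<Gamma> gen_b gen_c" "conj_sep \<Gamma> gen_c gen_b"
proof -
  have e: "conj_sep \<Gamma> (node False gen_a gen_c) (node False id gen_b)" "conj_sep \<Gamma> (node False id gen_b) (node False gen_a gen_c)"
     "conj_sep \<Gamma> (node False gen_a gen_d) (node False id gen_b)" "conj_sep \<Gamma> (node False id gen_b) (node False gen_a gen_d)"
    by (rule conj_sep_even; (intro gens_node_Gamma)?; simp add: conj_sep_a)+
  then show *: "conj_sep \<Gamma> gen_b gen_d" "conj_sep \<Gamma> gen_d gen_b" "conj_sep \<Gamma> gen_c gen_d" "conj_sep \<Gamma> gen_d gen_c"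
    by (simp_all only: flip: gen_b_node gen_c_node gen_d_node)
  have "conj_sep \<Gamma> (node False gen_a gen_c) (node False gen_a gen_d)" "conj_sep \<Gamma> (node False gen_a gen_d) (node False gen_a gen_c)"
    by (rule conj_sep_even; (intro gens_node_Gamma)?; simp add: conj_sep_a *)+
  then show "conj_sep \<Gamma> gen_b gen_c" "conj_sep \<Gamma> gen_c gen_b"
    by (simp_all only: flip: gen_b_node gen_c_node gen_d_node)
qed

lemma conj_lift_id: "conj_lift \<Gamma> id id m"
  unfolding conj_lift_def using normal_setD(2)[OF normal_set_KK] by (auto intro!: exI[of _ 0] bexI)

lemma conj_lift_a: "conj_lift \<Gamma> gen_a gen_a m"
proof -
  have "conj_lift \<Gamma> (node True id id) (node True id id) (Suc m)"
    by (rule conj_lift_odd) (use gens_node_Gamma conj_lift_id in simp_all)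
  then show ?thesis unfolding gen_a_node by (rule conj_lift_SucD)
qed

text \<open>In this and the next two lemmas the wreath recursion gains one level. Swapping
  conjugators are excluded because the two sections of the generator are separated from each
  other.\<close>

lemma conj_lift_c_step: "conj_lift \<Gamma> gen_d gen_d m \<Longrightarrow> conj_lift \<Gamma> gen_c gen_c (Suc m)"
  unfolding gen_c_node
  by (rule conj_lift_even) (use gens_node_Gamma conj_lift_a conj_sep_a in simp_all)

lemma conj_lift_b_step: "conj_lift \<Gamma> gen_c gen_c m \<Longrightarrow> conj_lift \<Gamma> gen_b gen_b (Suc m)"
  unfolding gen_b_node
  by (rule conj_lift_even) (use gens_node_Gamma conj_lift_a conj_sep_a in simp_all)

lemma conj_lift_d_step: "conj_lift \<Gamma> gen_b gen_b m \<Longrightarrow> conj_lift \<Gamma> gen_d gen_d (Suc m)"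
  by (subst (1 2) gen_d_node, rule conj_lift_even) (use gens_node_Gamma conj_lift_id conj_sep_1 in simp_all)

lemma conj_lift_d: "conj_lift \<Gamma> gen_d gen_d m"
proof (induction m)
  case 0
  show ?case
  proof (rule conj_lift_swap)
    \<comment> \<open>Every element of \<open>St1\<close> agrees modulo \<open>K0\<close> with an
      element centralizing \<open>d\<close>, so any level works.\<close>
    show "conj_lift St1 gen_d gen_d 0"
      unfolding conj_lift_def using St1_centralizer_d by auto
    \<comment> \<open>Outside \<open>St1\<close> nothing approximates a centralizing element: the
      sections of \<open>ada = (b, 1)\<close> and \<open>d = (1, b)\<close> at 0 are
      separated.\<close>
    have "conj_sep St1 (node False gen_b id) (node False id gen_b)"
      by (rule conj_sep_sections) (use gen_e_Gamma gens_node_Gamma conj_sep_1 in \<open>simp_all add: gen_e_node\<close>)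
    then show "conj_lift St1 (gen_a \<circ> gen_d \<circ> gen_a) gen_d 0"
      unfolding gen_e_def[symmetric] gen_e_node gen_d_node[symmetric] by (rule conj_sep_apx)
  qed
next
  case (Suc m)
  \<comment> \<open>One round through \<open>c\<close>, \<open>b\<close>, \<open>d\<close> gains
    three levels, of which two are dropped.\<close>
  then show ?case using conj_lift_SucD[OF conj_lift_SucD[OF conj_lift_d_step[OF conj_lift_b_step[OF conj_lift_c_step]]]] by blast
qed

text \<open>Base case of the contraction. \<open>r\<close> ranges over a set closed under sections,
  so it includes \<open>a\<close>; for \<open>s\<close> the generator \<open>a\<close> is covered by
  \<open>a_pairs\<close>. Distinct generators are separated.\<close>

lemma conj_lift_generators:
  assumes "r \<in> {id, gen_a, gen_b, gen_c, gen_d}" "s \<in> {id, gen_b, gen_c, gen_d}"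
  shows "conj_lift \<Gamma> r s m"
proof -
  have "conj_lift \<Gamma> gen_c gen_c m" "conj_lift \<Gamma> gen_b gen_b m"
    by (intro conj_lift_SucD[OF conj_lift_c_step] conj_lift_SucD[OF conj_lift_SucD[OF conj_lift_b_step[OF conj_lift_c_step]]] conj_lift_d)+
  then show ?thesis
    using assms by (auto simp: conj_lift_id conj_lift_d intro: conj_sep_apx conj_sep_a conj_sep_1 conj_sep_bcd)
qed

section \<open>Contraction\<close>

text \<open>The weights 3, 3, 2, 1 of \<open>a\<close>, \<open>b\<close>, \<open>c\<close>, \<open>d\<close> are chosen so that both sections of \<open>b\<close>, \<open>c\<close>, \<open>d\<close> together weigh less than the
  letter and a neighbouring \<open>a\<close>.\<close>

inductive word_weight :: "(word \<Rightarrow> word) \<Rightarrow> nat \<Rightarrow> bool" where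
  word_weight_id: "word_weight id 0"
| word_weight_a: "word_weight f n \<Longrightarrow> word_weight (gen_a \<circ> f) (3 + n)"
| word_weight_b: "word_weight f n \<Longrightarrow> word_weight (gen_b \<circ> f) (3 + n)"
| word_weight_c: "word_weight f n \<Longrightarrow> word_weight (gen_c \<circ> f) (2 + n)"
| word_weight_d: "word_weight f n \<Longrightarrow> word_weight (gen_d \<circ> f) (1 + n)"

lemma word_weight_exists:
  assumes "f \<in> \<Gamma>"
  shows "\<exists>n. word_weight f n"
  using assms by (induction rule: Gamma_induct) (blast intro: word_weight.intros)+

lemma word_weight_comp: "word_weight f n \<Longrightarrow> word_weight g m \<Longrightarrow> word_weight (f \<circ> g) (n + m)"
proof (induction rule: word_weight.induct)
  case (word_weight_a f n)
  then show ?case using word_weight.word_weight_a[of "f \<circ> g" "n + m"] by (simp add: comp_assoc add.assoc)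
next
  case (word_weight_b f n)
  then show ?case using word_weight.word_weight_b[of "f \<circ> g" "n + m"] by (simp add: comp_assoc add.assoc)
next
  case (word_weight_c f n)
  then show ?case using word_weight.word_weight_c[of "f \<circ> g" "n + m"] by (simp add: comp_assoc add.assoc)
next
  case (word_weight_d f n)
  then show ?case using word_weight.word_weight_d[of "f \<circ> g" "n + m"] by (simp add: comp_assoc add.assoc)
qed simp

lemma word_weight_gens: "word_weight gen_a 3" "word_weight gen_b 3" "word_weight gen_c 2" "word_weight gen_d 1"
  using word_weight_a[OF word_weight_id] word_weight_b[OF word_weight_id] word_weight_c[OF word_weight_id] word_weight_d[OF word_weight_id] by simp_all

section \<open>Block forms of words and the weights of their sections\<close>

definition stars :: "((word \<Rightarrow> word) \<times> nat) set" where
  "stars = {(id, 0), (gen_b, 3), (gen_c, 2), (gen_d, 1)}"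

lemma stars_Gamma: "(s, k) \<in> stars \<Longrightarrow> s \<in> \<Gamma>"
  by (auto simp: stars_def)

lemma stars_klein: "(s, k) \<in> stars \<Longrightarrow> s \<in> {id, gen_b, gen_c, gen_d}"
  by (auto simp: stars_def)

text \<open>Merging never increases the weight: 3, 2, 1 satisfy the triangle inequalities, with
  \<open>b = cd\<close> attaining equality.\<close>

lemma stars_comp:
  assumes "(s, k) \<in> stars" "(t, l) \<in> stars"
  shows "\<exists>j \<le> k + l. (s \<circ> t, j) \<in> stars"
proof -
  have 1: "(id, 0) \<in> stars" "(gen_b, 3) \<in> stars" "(gen_c, 2) \<in> stars" "(gen_d, 1) \<in> stars"
    by (auto simp: stars_def)
  have "\<exists>j\<le>k + l. (s \<circ> t, j) \<in> stars"
    if "(s, k) \<in> {(id, 0), (gen_b, 3), (gen_c, 2), (gen_d, 1)}" "(t, l) \<in> {(id, 0), (gen_b, 3), (gen_c, 2), (gen_d, 1)}"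
    using that 1
    by (elim insertE emptyE; simp only: prod.inject) (auto intro: exI[of _ 0] exI[of _ 1] exI[of _ 2] exI[of _ 3])
  then show ?thesis using assms unfolding stars_def by blast
qed

text \<open>Nonempty products of blocks \<open>a s\<close> with \<open>s\<close> in the Klein
  four-group. The letter \<open>s\<close> may be trivial, so no reducedness is demanded, and
  \<open>a\<close> itself is one block.\<close>

inductive a_pairs :: "(word \<Rightarrow> word) \<Rightarrow> nat \<Rightarrow> bool" where
  one: "(s, k) \<in> stars \<Longrightarrow> a_pairs (gen_a \<circ> s) (3 + k)"
| step: "(s, k) \<in> stars \<Longrightarrow> a_pairs f n \<Longrightarrow> a_pairs (gen_a \<circ> s \<circ> f) (3 + k + n)"

lemma a_pairs_Gamma: "a_pairs f n \<Longrightarrow> f \<in> \<Gamma>"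
  by (induction rule: a_pairs.induct) (auto dest: stars_Gamma)

lemma a_pairs_snoc:
  "a_pairs f n \<Longrightarrow> (t, l) \<in> stars \<Longrightarrow> \<exists>j\<le>n + l. a_pairs (f \<circ> t) j"
proof (induction rule: a_pairs.induct)
  case (one s k)
  obtain j where j: "j \<le> k + l" "(s \<circ> t, j) \<in> stars" using stars_comp[OF one] by blast
  have "a_pairs (gen_a \<circ> s \<circ> t) (3 + j)" using a_pairs.one[OF j(2)] by (simp only: comp_assoc)
  then show ?case using j(1) by (intro exI[of _ "3 + j"]) simp
next
  case (step s k f n)
  then obtain j where j: "j \<le> n + l" "a_pairs (f \<circ> t) j" by blast
  have "a_pairs (gen_a \<circ> s \<circ> f \<circ> t) (3 + k + j)"
    using a_pairs.step[OF step(1) j(2)] by (simp only: comp_assoc)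
  then show ?case using j(1) by (intro exI[of _ "3 + k + j"]) simp
qed

text \<open>A new \<open>a\<close> absorbs the leading letter \<open>s\<close> into a block and
  leaves the trivial one in front; any other new letter merges with \<open>s\<close>.\<close>

lemma word_weight_normal_form:
  "word_weight f n \<Longrightarrow> \<exists>s k. (s, k) \<in> stars \<and> (f = s \<and> k \<le> n \<or> (\<exists>g m. a_pairs g m \<and> f = s \<circ> g \<and> k + m \<le> n))"
proof (induction rule: word_weight.induct)
  case word_weight_id
  have "(id, 0) \<in> stars" by (simp add: stars_def)
  then show ?case by blast
next
  case (word_weight_a f n)
  have id: "(id, 0) \<in> stars" by (simp add: stars_def)
  obtain s k where s: "(s, k) \<in> stars" "f = s \<and> k \<le> n \<or> (\<exists>g m. a_pairs g m \<and> f = s \<circ> g \<and> k + m \<le> n)"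
    using word_weight_a.IH by blast
  from s(2) have "\<exists>g m. a_pairs g m \<and> gen_a \<circ> f = id \<circ> g \<and> 0 + m \<le> 3 + n"
  proof
    assume "f = s \<and> k \<le> n"
    then show ?thesis using a_pairs.one[OF s(1)] by (intro exI[of _ "gen_a \<circ> s"] exI[of _ "3 + k"]) simp
  next
    assume "\<exists>g m. a_pairs g m \<and> f = s \<circ> g \<and> k + m \<le> n"
    then obtain g m where g: "a_pairs g m" "f = s \<circ> g" "k + m \<le> n" by blast
    then show ?thesis using a_pairs.step[OF s(1) g(1)]
      by (intro exI[of _ "gen_a \<circ> s \<circ> g"] exI[of _ "3 + k + m"]) (simp add: comp_assoc)
  qed
  then show ?case using id by blast
next
  have star: "\<exists>s k. (s, k) \<in> stars \<and> (t \<circ> f = s \<and> k \<le> l + n \<or> (\<exists>g m. a_pairs g m \<and> t \<circ> f = s \<circ> g \<and> k + m \<le> l + n))"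
    if t: "(t, l) \<in> stars" and IH: "\<exists>s k. (s, k) \<in> stars \<and> (f = s \<and> k \<le> n \<or> (\<exists>g m. a_pairs g m \<and> f = s \<circ> g \<and> k + m \<le> n))"
    for t l f n
  proof -
    obtain s k where s: "(s, k) \<in> stars" "f = s \<and> k \<le> n \<or> (\<exists>g m. a_pairs g m \<and> f = s \<circ> g \<and> k + m \<le> n)"
      using IH by blast
    obtain j where j: "j \<le> l + k" "(t \<circ> s, j) \<in> stars" using stars_comp[OF t s(1)] by blast
    from s(2) have "t \<circ> f = t \<circ> s \<and> j \<le> l + n \<or> (\<exists>g m. a_pairs g m \<and> t \<circ> f = (t \<circ> s) \<circ> g \<and> j + m \<le> l + n)"
    proof
      assume "f = s \<and> k \<le> n"
      then show ?thesis using j(1) by auto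
    next
      assume "\<exists>g m. a_pairs g m \<and> f = s \<circ> g \<and> k + m \<le> n"
      then obtain g m where "a_pairs g m" "f = s \<circ> g" "k + m \<le> n" by blast
      then have "a_pairs g m \<and> t \<circ> f = (t \<circ> s) \<circ> g \<and> j + m \<le> l + n" using j(1) by (simp add: comp_assoc)
      then show ?thesis by blast
    qed
    then show ?thesis using j(2) by blast
  qed
  {
    case (word_weight_b f n)
    show ?case by (rule star[OF _ word_weight_b.IH]) (simp add: stars_def)
  next
    case (word_weight_c f n)
    show ?case by (rule star[OF _ word_weight_c.IH]) (simp add: stars_def)
  next
    case (word_weight_d f n)
    show ?case by (rule star[OF _ word_weight_d.IH]) (simp add: stars_def)
  }
qed

text \<open>Conjugation moves a leading letter other than \<open>a\<close> to the end of the word, where it merges.\<close>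

lemma word_weight_cyclic_form:
  assumes "word_weight f n"
  shows "\<exists>u\<in>\<Gamma>. \<exists>g\<in>\<Gamma>. f = u \<circ> g \<circ> iv u \<and> (g \<in> {id, gen_b, gen_c, gen_d} \<or> (\<exists>m\<le>n. a_pairs g m))"
proof -
  obtain s k where s: "(s, k) \<in> stars" "f = s \<or> (\<exists>g m. a_pairs g m \<and> f = s \<circ> g \<and> k + m \<le> n)"
    using word_weight_normal_form[OF assms] by blast
  from s(2) show ?thesis
  proof
    assume f: "f = s"
    show ?thesis
      by (rule bexI[of _ id], rule bexI[of _ s]) (use f stars_Gamma[OF s(1)] stars_klein[OF s(1)] in simp_all)
  next
    assume "\<exists>g m. a_pairs g m \<and> f = s \<circ> g \<and> k + m \<le> n"
    then obtain g m where g: "a_pairs g m" "f = s \<circ> g" "k + m \<le> n" by blast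
    obtain j where j: "j \<le> m + k" "a_pairs (g \<circ> s) j" using a_pairs_snoc[OF g(1) s(1)] by blast
    have sG: "s \<in> \<Gamma>" by (rule stars_Gamma[OF s(1)])
    have "f = s \<circ> (g \<circ> s) \<circ> iv s" unfolding g(2) using sG by (simp add: comp_assoc)
    moreover have "\<exists>m\<le>n. a_pairs (g \<circ> s) m" using j g(3) by (intro exI[of _ j]) simp
    ultimately show ?thesis using sG a_pairs_Gamma[OF j(2)] by blast
  qed
qed

text \<open>For \<open>id\<close>, \<open>b\<close>, \<open>c\<close>, \<open>d\<close> the
  inequalities are 0 < 3, 5 < 6, 4 < 5 and 3 < 4.\<close>

lemma star_sections:
  assumes "(s, k) \<in> stars"
  shows "\<exists>x y p q. s = node False x y \<and> word_weight x p \<and> word_weight y q \<and> p + q < 3 + k"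
proof -
  have "\<exists>x y p q. id = node False x y \<and> word_weight x p \<and> word_weight y q \<and> p + q < 3 + 0"
    by (rule exI[of _ id], rule exI[of _ id], rule exI[of _ 0], rule exI[of _ 0]) (simp add: word_weight_id)
  moreover have "\<exists>x y p q. gen_b = node False x y \<and> word_weight x p \<and> word_weight y q \<and> p + q < 3 + 3"
    by (rule exI[of _ gen_a], rule exI[of _ gen_c], rule exI[of _ 3], rule exI[of _ 2]) (simp add: word_weight_gens gen_b_node[symmetric])
  moreover have "\<exists>x y p q. gen_c = node False x y \<and> word_weight x p \<and> word_weight y q \<and> p + q < 3 + 2"
    by (rule exI[of _ gen_a], rule exI[of _ gen_d], rule exI[of _ 3], rule exI[of _ 1]) (simp add: word_weight_gens gen_c_node[symmetric] del: One_nat_def)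
  moreover have "\<exists>x y p q. gen_d = node False x y \<and> word_weight x p \<and> word_weight y q \<and> p + q < 3 + 1"
    by (rule exI[of _ id], rule exI[of _ gen_b], rule exI[of _ 0], rule exI[of _ 3]) (simp add: word_weight_gens word_weight_id gen_d_node[symmetric])
  moreover have "(s, k) = (id, 0) \<or> (s, k) = (gen_b, 3) \<or> (s, k) = (gen_c, 2) \<or> (s, k) = (gen_d, 1)"
    using assms by (simp add: stars_def)
  ultimately show ?thesis by (elim disjE) (simp_all only: prod.inject)
qed

text \<open>The bounds add up over the blocks. It is the sum \<open>p + q\<close> that drops, so
  even the product of the two sections, which arises for swapping elements, has smaller
  weight.\<close>

lemma a_pairs_sections:
  "a_pairs f n \<Longrightarrow> \<exists>e x y p q. f = node e x y \<and> word_weight x p \<and> word_weight y q \<and> p + q < n"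
proof (induction rule: a_pairs.induct)
  case (one s k)
  obtain x y p q where s: "s = node False x y" "word_weight x p" "word_weight y q" "p + q < 3 + k"
    using star_sections[OF one] by blast
  have "gen_a \<circ> s = node True x y" by (simp add: s(1) gen_a_node)
  with s(2-) show ?case by blast
next
  case (step s k f n)
  obtain x y p q where s: "s = node False x y" "word_weight x p" "word_weight y q" "p + q < 3 + k"
    using star_sections[OF step(1)] by blast
  obtain e x' y' p' q' where f: "f = node e x' y'" "word_weight x' p'" "word_weight y' q'" "p' + q' < n"
    using step.IH by blast
  show ?case
  proof (cases e)
    case True
    have "gen_a \<circ> s \<circ> f = node False (y \<circ> x') (x \<circ> y')" by (simp add: s(1) f(1) gen_a_node True)
    moreover have "q + p' + (p + q') < 3 + k + n" using s f by simp
    ultimately show ?thesis using word_weight_comp s f by blast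
  next
    case False
    have "gen_a \<circ> s \<circ> f = node True (x \<circ> x') (y \<circ> y')" by (simp add: s(1) f(1) gen_a_node False)
    moreover have "p + p' + (q + q') < 3 + k + n" using s f by simp
    ultimately show ?thesis using word_weight_comp s f by blast
  qed
qed

text \<open>Induction on the weight of \<open>g\<close> alone: the sections of a generator are again
  generators or trivial, so \<open>r\<close> stays in its set while \<open>g\<close>
  contracts.\<close>

lemma conj_lift_generator_left:
  "word_weight g n \<Longrightarrow> r \<in> {id, gen_a, gen_b, gen_c, gen_d} \<Longrightarrow> conj_lift \<Gamma> r g m"
proof (induction n arbitrary: g r m rule: less_induct)
  case (less n g r m)
  obtain u g' where u: "u \<in> \<Gamma>" "g' \<in> \<Gamma>" "g = u \<circ> g' \<circ> iv u" "g' \<in> {id, gen_b, gen_c, gen_d} \<or> (\<exists>m\<le>n. a_pairs g' m)"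
    using word_weight_cyclic_form[OF less.prems(1)] by blast
  have rG: "r \<in> \<Gamma>" using less.prems(2) by auto
  have "conj_lift \<Gamma> r g' m"
    using u(4)
  proof
    assume "g' \<in> {id, gen_b, gen_c, gen_d}"
    then show ?thesis using conj_lift_generators less.prems(2) by blast
  next
    assume "\<exists>m\<le>n. a_pairs g' m"
    then obtain j where "j \<le> n" "a_pairs g' j" by blast
    then obtain e x y p q where g': "g' = node e x y" "word_weight x p" "word_weight y q" "p + q < n"
      using a_pairs_sections[of g' j] by (meson less_le_trans)
    have IH: "conj_lift \<Gamma> s x m" "conj_lift \<Gamma> s y m" if "s \<in> {id, gen_a, gen_b, gen_c, gen_d}" for s
      using less.IH[OF _ g'(2) that] less.IH[OF _ g'(3) that] g'(4) by auto
    show ?thesis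
    proof (cases "r = gen_a")
      case True
      have "conj_lift \<Gamma> (node True id id) (node e x y) m"
      proof (cases e)
        case True
        \<comment> \<open>Both sections of \<open>a\<close> are trivial, so the odd case compares
          \<open>id\<close> with the product \<open>y \<circ> x\<close> of weight below
          \<open>n\<close>.\<close>
        have "conj_lift \<Gamma> (id \<circ> id) (y \<circ> x) m"
          using less.IH[OF _ word_weight_comp[OF g'(3,2)], of id] g'(4) by simp
        then show ?thesis using True u(2) gens_node_Gamma(1) unfolding g'(1)
          by (simp add: conj_lift_odd[THEN conj_lift_SucD])
      next
        case False
        then show ?thesis using u(2) gens_node_Gamma(1) unfolding g'(1)
          by (intro conj_sep_apx conj_sep_parity) auto
      qed
      then show ?thesis using True g'(1) gen_a_node by simp
    next
      case False
      then have "r = id \<or> r = gen_b \<or> r = gen_c \<or> r = gen_d" using less.prems(2) by blast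
      then obtain r0 r1 where r: "r = node False r0 r1" "r0 \<in> {id, gen_a, gen_b, gen_c, gen_d}" "r1 \<in> {id, gen_a, gen_b, gen_c, gen_d}"
        using node_id[symmetric] gen_b_node gen_c_node gen_d_node by blast
      show ?thesis
      proof (cases e)
        case True
        then show ?thesis using u(2) rG unfolding g'(1) r(1) by (intro conj_sep_apx conj_sep_parity) auto
      next
        case False
        then have "conj_lift \<Gamma> (node False r0 r1) (node False x y) (Suc m)"
          using u(2) rG unfolding g'(1) r(1) by (intro conj_lift_even IH r disjI1 conjI) auto
        then show ?thesis using False unfolding g'(1) r(1) by (simp add: conj_lift_SucD)
      qed
    qed
  qed
  then have "conj_lift \<Gamma> (id \<circ> r \<circ> iv id) (u \<circ> g' \<circ> iv u) m"
    using rG u by (intro conj_lift_conj) auto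
  then show ?case using u(3) by simp
qed

text \<open>Induction on the weight of \<open>f\<close> with \<open>g\<close> arbitrary, so no
  control over the sections of \<open>g\<close> is required. Once \<open>f\<close> is conjugate to a
  generator or \<open>id\<close>, \<open>conj_lift_generator_left\<close> takes over.\<close>

lemma conj_lift_wt:
  "word_weight f n \<Longrightarrow> g \<in> \<Gamma> \<Longrightarrow> conj_lift \<Gamma> f g m"
proof (induction n arbitrary: f g m rule: less_induct)
  case (less n f g m)
  obtain u f' where u: "u \<in> \<Gamma>" "f' \<in> \<Gamma>" "f = u \<circ> f' \<circ> iv u" "f' \<in> {id, gen_b, gen_c, gen_d} \<or> (\<exists>m\<le>n. a_pairs f' m)"
    using word_weight_cyclic_form[OF less.prems(1)] by blast
  have "conj_lift \<Gamma> f' g m"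
    using u(4)
  proof
    assume "f' \<in> {id, gen_b, gen_c, gen_d}"
    then show ?thesis using conj_lift_generator_left word_weight_exists[OF less.prems(2)] by blast
  next
    assume "\<exists>m\<le>n. a_pairs f' m"
    then obtain j where "j \<le> n" "a_pairs f' j" by blast
    then obtain e x y p q where f': "f' = node e x y" "word_weight x p" "word_weight y q" "p + q < n"
      using a_pairs_sections[of f' j] by (meson less_le_trans)
    obtain e' x' y' where g: "x' \<in> \<Gamma>" "y' \<in> \<Gamma>" "g = node e' x' y'" using less.prems(2) by (rule Gamma_cases)
    have G: "node e x y \<in> \<Gamma>" "node e' x' y' \<in> \<Gamma>" using u(2) less.prems(2) f'(1) g(3) by simp_all
    have IH: "conj_lift \<Gamma> x h m" "conj_lift \<Gamma> y h m" if "h \<in> \<Gamma>" for h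
      using less.IH[OF _ f'(2) that] less.IH[OF _ f'(3) that] f'(4) by auto
    have IH2: "conj_lift \<Gamma> (y \<circ> x) (y' \<circ> x') m"
      using less.IH[OF _ word_weight_comp[OF f'(3,2)]] f'(4) g by simp
    show ?thesis
    proof (cases "e = e'")
      case False
      then show ?thesis unfolding f'(1) g(3) by (intro conj_sep_apx conj_sep_parity G)
    next
      case True
      have "conj_lift \<Gamma> (node e x y) (node e' x' y') (Suc m)"
      proof (cases e)
        case e: True
        show ?thesis using G IH2 e True by (simp add: conj_lift_odd)
      next
        case e: False
        show ?thesis using G IH g(1,2) e True by (simp add: conj_lift_even)
      qed
      then show ?thesis unfolding f'(1) g(3) by (rule conj_lift_SucD)
    qed
  qed
  then have "conj_lift \<Gamma> (u \<circ> f' \<circ> iv u) (id \<circ> g \<circ> iv id) m"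
    using less.prems u by (intro conj_lift_conj) auto
  then show ?case using u(3) by simp
qed

text \<open>The bound \<open>n \<ge> m\<close> places \<open>KK n\<close> inside every subgroup that
  contains \<open>KK m\<close>.\<close>

theorem approximate_conjugators:
  assumes "f \<in> \<Gamma>" "g \<in> \<Gamma>"
  obtains n where "n \<ge> m" "\<And>h. h \<in> \<Gamma> \<Longrightarrow> h \<circ> f \<circ> iv h \<circ> iv g \<in> KK n \<Longrightarrow>
    \<exists>h'\<in>\<Gamma>. h' \<circ> f \<circ> iv h' = g \<and> iv h \<circ> h' \<in> KK m"
proof -
  obtain k where "word_weight f k" using word_weight_exists[OF assms(1)] by blast
  from conj_lift_level[OF conj_lift_wt[OF this assms(2)], of m m] that show thesis by blast
qed

section \<open>Passage to finite 2-groups\<close>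

text \<open>An odd prime \<open>q\<close> dividing the order would give a subgroup of order
  \<open>q\<close> by Sylow, whose nontrivial elements have order dividing both \<open>q\<close> and
  \<open>2 ^ k\<close>.\<close>

lemma (in group) order_power_of_2:
  assumes fin: "finite (carrier G)" and exp: "\<And>x. x \<in> carrier G \<Longrightarrow> x [^] (2 ^ k :: nat) = \<one>"
  shows "\<exists>n. order G = 2 ^ n"
proof -
  have "order G \<noteq> 0" using fin one_closed by (auto simp: order_def)
  then obtain m where m: "order G = 2 ^ multiplicity 2 (order G) * m" "\<not> 2 dvd m"
    using multiplicity_decompose'[of "order G" 2] by auto
  have "m = 1"
  proof (rule ccontr)
    assume "m \<noteq> 1"
    then obtain q where q: "Factorial_Ring.prime (q :: nat)" "q dvd m" using prime_factor_nat by blast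
    have "q \<noteq> 2" using q m(2) by auto
    then have cop: "coprime q (2 ^ k)" using primes_coprime[OF q(1) two_is_prime_nat] by simp
    have "q dvd order G" using q(2) m(1) by (metis dvd_mult)
    \<comment> \<open>Sylow's theorem for the exponent 1; \<open>r\<close> may still be divisible by
      \<open>q\<close>.\<close>
    then obtain r where "order G = q ^ 1 * r" by (auto elim: dvdE)
    then obtain H where H: "subgroup H G" "card H = q ^ 1"
      using sylow_thm[OF q(1) is_group _ fin] by blast
    have "card H > 1" using H(2) prime_gt_1_nat[OF q(1)] by simp
    then obtain x where x: "x \<in> H" "x \<noteq> \<one>"
      by (metis card_le_Suc0_iff_eq card.infinite linorder_not_less One_nat_def not_less_zero less_Suc_eq_le subgroup.one_closed[OF H(1)])
    have xG: "x \<in> carrier G" using H(1) x(1) by (rule subgroup.mem_carrier)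
    have "x [^]\<^bsub>G\<lparr>carrier := H\<rparr>\<^esub> order (G\<lparr>carrier := H\<rparr>) = \<one>\<^bsub>G\<lparr>carrier := H\<rparr>\<^esub>"
      using group.pow_order_eq_1[OF subgroup.subgroup_is_group[OF H(1) is_group]] x(1) by simp
    then have "x [^] q = \<one>"
      using H(2) by (simp add: order_def nat_pow_consistent[symmetric])
    then have "ord x dvd q" "ord x dvd 2 ^ k"
      using exp[OF xG] pow_eq_id[OF xG] by blast+
    then have "ord x = 1" using cop by (metis coprime_common_divisor_nat)
    then show False using x(2) ord_eq_1[OF xG] by simp
  qed
  then show ?thesis using m(1) by auto
qed

lemma conjugate_iso:
  assumes j: "j \<in> iso G Q" and G: "group G" "group Q" and ab: "a \<in> carrier G" "b \<in> carrier G"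
    and conj: "conjugate Q (j a) (j b)"
  shows "conjugate G a b"
proof -
  have hom: "j \<in> hom G Q" and bij: "bij_betw j (carrier G) (carrier Q)" using j by (auto simp: iso_def)
  interpret group_hom G Q j using G hom by (simp add: group_hom_def group_hom_axioms_def)
  obtain y where y: "y \<in> carrier Q" "j b = y \<otimes>\<^bsub>Q\<^esub> j a \<otimes>\<^bsub>Q\<^esub> inv\<^bsub>Q\<^esub> y"
    using conj by (auto simp: conjugate_def)
  then obtain x where x: "x \<in> carrier G" "y = j x" using bij by (auto simp: bij_betw_def)
  have "j b = j (x \<otimes>\<^bsub>G\<^esub> a \<otimes>\<^bsub>G\<^esub> inv\<^bsub>G\<^esub> x)" using x y ab by simp
  then have "b = x \<otimes>\<^bsub>G\<^esub> a \<otimes>\<^bsub>G\<^esub> inv\<^bsub>G\<^esub> x"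
    by (rule inj_onD[OF bij_betw_imp_inj_on[OF bij]]) (use ab x in simp_all)
  then show ?thesis using x by (auto simp: conjugate_def)
qed

text \<open>The quotient of \<open>H\<close> by \<open>KK n\<close> from
  \<open>approximate_conjugators\<close> separates: a conjugator in it lifts to an approximate one
  in \<open>H\<close>, which could be corrected to an exact one.\<close>

lemma two_conjugacy_separable_subgroup:
  assumes H: "subgroup H Grigorchuk" and KH: "KK m \<subseteq> H"
  shows "two_conjugacy_separable (Grigorchuk\<lparr>carrier := H\<rparr>)"
  unfolding two_conjugacy_separable_def
proof (intro ballI impI)
  let ?G = "Grigorchuk\<lparr>carrier := H\<rparr>"
  fix f g assume fg: "f \<in> carrier ?G" "g \<in> carrier ?G" and nc: "\<not> conjugate ?G f g"
  interpret G: group ?G using subgroup.subgroup_is_group[OF H group_Grigorchuk] .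
  have HG: "x \<in> \<Gamma>" if "x \<in> H" for x using subgroup.mem_carrier[OF H that] .
  have inv_G: "inv\<^bsub>?G\<^esub> x = iv x" if "x \<in> H" for x
    using group.m_inv_consistent[OF group_Grigorchuk H that] m_inv_Grigorchuk[OF HG[OF that]] by simp
  have mult_G: "x \<otimes>\<^bsub>?G\<^esub> y = x \<circ> y" for x y by (simp add: mult_Grigorchuk)
  have fgG: "f \<in> \<Gamma>" "g \<in> \<Gamma>" using fg HG by auto
  obtain n where n: "n \<ge> m" "\<And>h. h \<in> \<Gamma> \<Longrightarrow> h \<circ> f \<circ> iv h \<circ> iv g \<in> KK n \<Longrightarrow>
      \<exists>h'\<in>\<Gamma>. h' \<circ> f \<circ> iv h' = g \<and> iv h \<circ> h' \<in> KK m"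
    using approximate_conjugators[OF fgG, of m] by blast
  let ?L = "KK n"
  have LH: "?L \<subseteq> H" using KK_mono[OF n(1)] KH by blast
  have L: "?L \<lhd> ?G"
    unfolding G.normal_inv_iff
  proof (intro conjI ballI)
    show "subgroup ?L ?G"
    proof (rule G.subgroupI)
      show "?L \<subseteq> carrier ?G" "?L \<noteq> {}" using LH normal_setD(2)[OF normal_set_KK] by auto
      fix x y assume "x \<in> ?L" "y \<in> ?L"
      then show "inv\<^bsub>?G\<^esub> x \<in> ?L" "x \<otimes>\<^bsub>?G\<^esub> y \<in> ?L"
        using LH inv_G[of x] normal_setD(3,4)[OF normal_set_KK] by (auto simp: mult_Grigorchuk)
    qed
    fix x h assume "x \<in> carrier ?G" "h \<in> ?L"
    then show "x \<otimes>\<^bsub>?G\<^esub> h \<otimes>\<^bsub>?G\<^esub> inv\<^bsub>?G\<^esub> x \<in> ?L"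
      using normal_setD(5)[OF normal_set_KK] HG by (simp add: inv_G mult_Grigorchuk)
  qed
  interpret L: normal ?L ?G by (rule L)
  let ?Q = "?G Mod ?L"
  let ?p = "\<lambda>x. ?L #>\<^bsub>?G\<^esub> x"
  have coset: "?p x = (\<lambda>k. k \<circ> x) ` KK n" for x
    by (auto simp: r_coset_def mult_Grigorchuk)
  have Q: "group ?Q" by (rule L.factorgroup_is_group)
  have carr: "carrier ?Q = ?p ` H" by (auto simp: FactGroup_def RCOSETS_def)
  have "?p ` H \<subseteq> (\<lambda>h. (\<lambda>k. k \<circ> h) ` KK n) ` \<Gamma>"
  proof (rule image_subsetI)
    fix x assume "x \<in> H"
    then show "?p x \<in> (\<lambda>h. (\<lambda>k. k \<circ> h) ` KK n) ` \<Gamma>" unfolding coset using HG by blast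
  qed
  then have finQ: "finite (carrier ?Q)" unfolding carr using cosets_KK_finite finite_subset by blast
  have p_hom: "?p \<in> hom ?G ?Q" by (rule L.r_coset_hom_Mod)
  interpret p: group_hom ?G ?Q ?p using p_hom Q by (simp add: group_hom_def group_hom_axioms_def G.is_group)
  have pow: "x [^]\<^bsub>?G\<^esub> i = x ^^ i" for x and i :: nat
  proof (induction i)
    case 0
    then show ?case by (simp add: one_Grigorchuk nat_pow_def)
  next
    case (Suc i)
    then show ?case by (simp only: G.nat_pow_Suc mult_G funpow_Suc_right)
  qed
  obtain k where k: "\<And>x. x \<in> \<Gamma> \<Longrightarrow> x ^^ 2 ^ k \<in> KK n" using KK_exponent by blast
  have expQ: "y [^]\<^bsub>?Q\<^esub> (2 ^ k :: nat) = \<one>\<^bsub>?Q\<^esub>" if "y \<in> carrier ?Q" for y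
  proof -
    obtain x where x: "x \<in> H" "y = ?p x" using \<open>y \<in> carrier ?Q\<close> unfolding carr by blast
    have "y [^]\<^bsub>?Q\<^esub> (2 ^ k :: nat) = ?p (x ^^ 2 ^ k)"
      unfolding x(2) using p.hom_nat_pow[of x "2 ^ k"] x(1) by (simp add: pow)
    also have "\<dots> = ?L" using L.rcos_const[OF G.is_group k[OF HG[OF x(1)]]] .
    finally show ?thesis by (simp add: FactGroup_def)
  qed
  obtain i where i: "order ?Q = 2 ^ i" using group.order_power_of_2[OF Q finQ expQ] by blast
  \<comment> \<open>Cosets are sets of functions, whereas the definition asks for a group of natural
    numbers; the finite quotient is transported along an injection.\<close>
  obtain j :: "(word \<Rightarrow> word) set \<Rightarrow> nat" where j: "inj_on j (carrier ?Q)"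
    using finite_imp_inj_to_nat_seg[OF finQ] by blast
  let ?R = "image_group j ?Q"
  have R: "group ?R" by (rule group.inj_imp_image_group_is_group[OF Q j])
  have iso: "j \<in> iso ?Q ?R" by (rule inj_imp_image_group_iso[OF j])
  have R_carrier: "carrier ?R = j ` carrier ?Q" by (rule image_group_carrier)
  have "finite_2_group ?R"
    unfolding finite_2_group_def using R finQ i j by (auto simp: R_carrier order_def card_image)
  moreover have "(\<lambda>x. j (?p x)) \<in> epi ?G ?R"
  proof -
    have "j \<circ> ?p \<in> hom ?G ?R" using hom_compose[OF p_hom] iso by (auto simp: iso_def)
    then show ?thesis unfolding epi_def R_carrier carr by (auto simp: comp_def)
  qed
  moreover have "\<not> conjugate ?R (j (?p f)) (j (?p g))"
  proof
    assume conj: "conjugate ?R (j (?p f)) (j (?p g))"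
    have "?p f \<in> carrier ?Q" "?p g \<in> carrier ?Q" unfolding carr using fg by auto
    from conjugate_iso[OF iso Q R this conj] obtain h where h: "h \<in> H" "?p g = ?p h \<otimes>\<^bsub>?Q\<^esub> ?p f \<otimes>\<^bsub>?Q\<^esub> inv\<^bsub>?Q\<^esub> ?p h"
      unfolding conjugate_def carr by blast
    have "?p h \<otimes>\<^bsub>?Q\<^esub> ?p f \<otimes>\<^bsub>?Q\<^esub> inv\<^bsub>?Q\<^esub> ?p h = ?p (h \<otimes>\<^bsub>?G\<^esub> f \<otimes>\<^bsub>?G\<^esub> inv\<^bsub>?G\<^esub> h)"
    proof -
      have hG: "h \<in> carrier ?G" using h(1) by simp
      show ?thesis
        using p.hom_mult[OF G.m_closed[OF hG fg(1)] G.inv_closed[OF hG]] p.hom_mult[OF hG fg(1)] p.hom_inv[OF hG]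
        by (simp only:)
    qed
    with h(2) have "?p g = ?p (h \<circ> f \<circ> iv h)"
      using inv_G[OF h(1)] by (simp add: mult_Grigorchuk)
    moreover have "h \<circ> f \<circ> iv h \<in> ?p (h \<circ> f \<circ> iv h)"
      unfolding coset using normal_setD(2)[OF normal_set_KK] by (intro image_eqI[of _ _ id]) auto
    ultimately obtain l where l: "l \<in> KK n" "h \<circ> f \<circ> iv h = l \<circ> g" unfolding coset by blast
    then have "h \<circ> f \<circ> iv h \<circ> iv g \<in> KK n" using fgG by (simp add: comp_assoc)
    then obtain h' where h': "h' \<in> \<Gamma>" "h' \<circ> f \<circ> iv h' = g" "iv h \<circ> h' \<in> KK m"
      using n(2) HG[OF h(1)] by blast
    \<comment> \<open>The corrected \<open>h'\<close> is only known to lie in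
      \<open>\<Gamma>\<close>; it lies in \<open>H\<close> because \<open>h\<close> does and
      \<open>iv h \<circ> h'\<close> is in \<open>KK m\<close>.\<close>
    have "h \<circ> (iv h \<circ> h') \<in> H"
      using subgroup.m_closed[OF H h(1)] h'(3) KH by (auto simp: mult_Grigorchuk)
    then have "h' \<in> H" using HG[OF h(1)] by simp
    then have "conjugate ?G f g"
      unfolding conjugate_def using h'(2) inv_G by (auto simp: mult_Grigorchuk)
    with nc show False by blast
  qed
  ultimately show "\<exists>(Q :: nat monoid) \<pi>. finite_2_group Q \<and> \<pi> \<in> epi ?G Q \<and> \<not> conjugate Q (\<pi> f) (\<pi> g)"
    by blast
qed

lemma two_conjugacy_separable_imp: "two_conjugacy_separable G \<Longrightarrow> conjugacy_separable G"
  unfolding two_conjugacy_separable_def conjugacy_separable_def finite_2_group_def by blast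

theorem theorem5p15:
  "hereditarily_conjugacy_separable Grigorchuk \<and> two_hereditarily_conjugacy_separable Grigorchuk"
proof -
  have "subgroup \<Gamma> Grigorchuk" by (rule group.subgroup_self[OF group_Grigorchuk])
  moreover have "KK 0 \<subseteq> \<Gamma>" using KK_Gamma by blast
  ultimately have 1: "two_conjugacy_separable Grigorchuk"
    using two_conjugacy_separable_subgroup[of \<Gamma> 0] by simp
  have 2: "two_conjugacy_separable (Grigorchuk\<lparr>carrier := H\<rparr>)"
    if "subgroup H Grigorchuk" "finite (rcosets\<^bsub>Grigorchuk\<^esub> H)" for H
    using congruence_subgroup[OF that] two_conjugacy_separable_subgroup[OF that(1)] by blast
  have 3: "two_conjugacy_separable (Grigorchuk\<lparr>carrier := H\<rparr>)"
    if H: "subgroup H Grigorchuk" and N: "N \<lhd> Grigorchuk" "N \<subseteq> H" "finite_2_group (Grigorchuk Mod N)" for H N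
  proof -
    \<comment> \<open>The carrier of the quotient is the set of cosets, so \<open>N\<close> has
      finite index and contains some \<open>KK m\<close>, which \<open>H\<close> then contains
      too.\<close>
    have "finite (rcosets\<^bsub>Grigorchuk\<^esub> N)" using N(3) by (simp add: finite_2_group_def FactGroup_def)
    then obtain m where "KK m \<subseteq> N" using congruence_subgroup normal_imp_subgroup[OF N(1)] by blast
    then show ?thesis using two_conjugacy_separable_subgroup[OF H] N(2) by blast
  qed
  show ?thesis
    unfolding hereditarily_conjugacy_separable_def two_hereditarily_conjugacy_separable_def
    using 1 2 3 two_conjugacy_separable_imp by blast
qed

end
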